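(* Let $f_{\tau}$ be the density of the distribution of the trace function $\tau(m)=\mathrm{Trace}\, m$ on $G=\mathrm{USp}_4$. If $x\in\mathbb{R}$ and $|x|<4$, then $$f_{\tau}(x)=\frac{1}{4\pi}\left(1-\frac{x^{2}}{16}\right)^{4}\ {}_2F_1\left(\frac32,\frac52;5;1-\frac{x^{2}}{16}\right).$$
   Context: $\mathrm{USp}_{4}=\{m\in \mathrm{GL}_{4}(\mathbb{C}) : {}^t m J m=J,\ {}^t m\,\bar m=I_{4}\}$ with $J=\begin{pmatrix}0&I_2\\-I_2&0\end{pmatrix}$, equipped with the Haar measure $dm$ of total mass $1$. The trace $\tau(m)=\mathrm{Trace}\, m$ is real with values in $[-4,4]$; its distribution is the image of $dm$ under $\tau$, and $f_\tau$ denotes the continuous density of this distribution: $\int_G\varphi(\tau(m))\,dm=\int_{-4}^{4}\varphi(x)f_\tau(x)\,dx$ for every continuous $\varphi$ on $[-4,4]$. ${}_2F_1(a,b;c;z)=\sum_{n\ge0}\frac{(a)_n(b)_n}{(c)_n}\frac{z^n}{n!}$ with $(a)_n=a(a+1)\cdots(a+n-1)$ is Gauss' hypergeometric series (for the parameters above it also converges at $z=1$). *)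

theory Defs
  imports "HOL-Analysis.Analysis" "HOL-Probability.Probability_Measure"
begin

definition J4 :: "complex^4^4" where
  "J4 = vector [vector [ 0,  0, 1, 0],
                vector [ 0,  0, 0, 1],
                vector [-1,  0, 0, 0],
                vector [ 0, -1, 0, 0]]"

(* The type 4 is enumerated as 1, 2, 3, 4 (with 4 = 0); this confirms that the nested lists
   above are the rows of the block matrix (0, I; -I, 0). *)
lemma J4_entries:
  "J4 $ 1 $ 1 = 0" "J4 $ 1 $ 2 = 0" "J4 $ 1 $ 3 = 1" "J4 $ 1 $ 4 = 0"
  "J4 $ 2 $ 1 = 0" "J4 $ 2 $ 2 = 0" "J4 $ 2 $ 3 = 0" "J4 $ 2 $ 4 = 1"
  "J4 $ 3 $ 1 = -1" "J4 $ 3 $ 2 = 0" "J4 $ 3 $ 3 = 0" "J4 $ 3 $ 4 = 0"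
  "J4 $ 4 $ 1 = 0" "J4 $ 4 $ 2 = -1" "J4 $ 4 $ 3 = 0" "J4 $ 4 $ 4 = 0"
  by (simp_all add: J4_def vector_def)

definition USp4 :: "(complex^4^4) set" where
  "USp4 = {m. invertible m \<and> transpose m ** J4 ** m = J4 \<and>
              transpose m ** map_matrix cnj m = mat 1}"

(* Left-invariant Borel probability measure on a group of matrices with its subspace topology.
   For a compact group (as USp4) this determines the measure, and right invariance and
   regularity are automatic. *)
definition normalized_haar_measure ::
    "(complex^'n^'n) set \<Rightarrow> (complex^'n^'n) measure \<Rightarrow> bool" where
  "normalized_haar_measure G M \<longleftrightarrow>
     sets M = sets (restrict_space borel G) \<and> prob_space M \<and>
     (\<forall>g\<in>G. distr M M (\<lambda>m. g ** m) = M)"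

(* The trace is real on USp4, so Re only converts its type.  The density is determined on
   {-4..4} alone; the values of f outside this interval are irrelevant. *)
definition continuous_trace_density :: "(complex^4^4) measure \<Rightarrow> (real \<Rightarrow> real) \<Rightarrow> bool" where
  "continuous_trace_density M f \<longleftrightarrow>
     continuous_on {-4..4} f \<and>
     (\<forall>\<phi> :: real \<Rightarrow> real. continuous_on {-4..4} \<phi> \<longrightarrow>
        (\<integral>m. \<phi> (Re (trace m)) \<partial>M) = (LBINT x:{-4..4}. \<phi> x * f x))"

(* As with any suminf, meaningful only where the series converges. *)
definition hyp2F1 :: "real \<Rightarrow> real \<Rightarrow> real \<Rightarrow> real \<Rightarrow> real" where
  "hyp2F1 a b c z = (\<Sum>n. pochhammer a n * pochhammer b n / pochhammer c n * (z ^ n / fact n))"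

end

theory Submission
  imports Defs
begin

text \<open>
  Both sides are continuous on \<open>[-4,4]\<close>, so it suffices to compare moments. Differentiating the
  invariance of the Haar measure along one-parameter subgroups, applied to \<open>tr (X m) (tr m)\<^sup>a\<close> and
  \<open>tr (X m\<^sup>2) (tr m)\<^sup>a\<close> and summed over an orthogonal basis of Lie algebra elements \<open>X\<close>, gives two
  linear relations (Schwinger-Dyson equations) between the integrals of \<open>(tr m)\<^sup>k\<close>,
  \<open>(tr m)\<^sup>k\<^sup>+\<^sup>2\<close> and \<open>(tr m)\<^sup>k tr m\<^sup>2\<close>. Eliminating the last one leaves
  \<open>(k + 6) (k + 8) \<mu>(k + 2) = 16 (k + 1) (k + 3) \<mu>(k)\<close> for the moments \<open>\<mu>\<close> of the trace. On the
  other side, integrating the hypergeometric series term by term turns the even moments into values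
  of \<open>\<^sub>2F\<^sub>1\<close> at 1, which Gauss' summation theorem evaluates; they satisfy the same recurrence with
  the same initial values.
\<close>

subsection \<open>The Lie algebra of the compact symplectic group\<close>

text \<open>An orthogonal basis of the Lie algebra of \<^const>\<open>USp4\<close>, chosen so that every element squares to
  \<open>-1\<close>; the one-parameter groups are then simply \<open>cos t + sin t X\<close>.\<close>

definition sp4_basis :: "(complex^4^4) list" where
  "sp4_basis =
    [vector [vector [\<i>,0,0,0], vector [0,\<i>,0,0], vector [0,0,-\<i>,0], vector [0,0,0,-\<i>]],
     vector [vector [\<i>,0,0,0], vector [0,-\<i>,0,0], vector [0,0,-\<i>,0], vector [0,0,0,\<i>]],
     vector [vector [0,\<i>,0,0], vector [\<i>,0,0,0], vector [0,0,0,-\<i>], vector [0,0,-\<i>,0]],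
     vector [vector [0,1,0,0], vector [-1,0,0,0], vector [0,0,0,1], vector [0,0,-1,0]],
     vector [vector [0,0,1,0], vector [0,0,0,1], vector [-1,0,0,0], vector [0,-1,0,0]],
     vector [vector [0,0,1,0], vector [0,0,0,-1], vector [-1,0,0,0], vector [0,1,0,0]],
     vector [vector [0,0,0,1], vector [0,0,1,0], vector [0,-1,0,0], vector [-1,0,0,0]],
     vector [vector [0,0,\<i>,0], vector [0,0,0,\<i>], vector [\<i>,0,0,0], vector [0,\<i>,0,0]],
     vector [vector [0,0,\<i>,0], vector [0,0,0,-\<i>], vector [\<i>,0,0,0], vector [0,-\<i>,0,0]],
     vector [vector [0,0,0,\<i>], vector [0,0,\<i>,0], vector [0,\<i>,0,0], vector [\<i>,0,0,0]]]"

text \<open>Adjoint for the symplectic form, \<open>J\<^sup>-\<^sup>1 m\<^sup>T J\<close> with \<open>J\<^sup>-\<^sup>1 = - J\<close>.\<close>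

definition symp_adj :: "complex^4^4 \<Rightarrow> complex^4^4" where
  "symp_adj m = - (J4 ** transpose m ** J4)"

lemma vector_4_nth [simp]:
  "(vector [a, b, c, d] :: 'a::zero^4) $ 1 = a"
  "(vector [a, b, c, d] :: 'a::zero^4) $ 2 = b"
  "(vector [a, b, c, d] :: 'a::zero^4) $ 3 = c"
  "(vector [a, b, c, d] :: 'a::zero^4) $ 4 = d"
  by (simp_all add: vector_def)

lemmas mat4_expand = vec_eq_iff forall_4 matrix_matrix_mult_def sum_4 trace_def mat_def transpose_def

text \<open>With \<open>\<i>\<close> factored out of the sums its square becomes -1, and what
  remains for \<open>algebra\<close> is a polynomial identity in the matrix entries.\<close>

lemma ii_collect:
  "\<i> * a + \<i> * b = \<i> * (a + b)"  "\<i> * a - \<i> * b = \<i> * (a - b)"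
  "- (\<i> * a) + \<i> * b = \<i> * (b - a)"  "- (\<i> * a) - \<i> * b = - (\<i> * (a + b))"
  "(\<i> * a) * (\<i> * b) = - (a * b)"  "\<i> * a * \<i> = - a"
  by (simp_all add: algebra_simps)

text \<open>If \<open>m\<close> has the 2 x 2 blocks A, B above C, D, the new blocks are the
  transposes of D, -B above those of -C, A.\<close>

lemma symp_adj_entries:
  "symp_adj m = vector [vector [m$3$3, m$4$3, -m$1$3, -m$2$3],
                        vector [m$3$4, m$4$4, -m$1$4, -m$2$4],
                        vector [-m$3$1, -m$4$1, m$1$1, m$2$1],
                        vector [-m$3$2, -m$4$2, m$1$2, m$2$2]]"
  by (simp add: symp_adj_def mat4_expand J4_entries)

lemma sp4_basis_square:
  assumes "X \<in> set sp4_basis"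
  shows "X ** X = - mat 1"
  using assms unfolding sp4_basis_def list.set
  by (elim insertE emptyE; simp only:; simp add: mat4_expand)

text \<open>Linearisation at the identity of the symplectic condition; the next lemma is that of
  unitarity. Together they put the basis into the Lie algebra.\<close>

lemma sp4_basis_symplectic:
  assumes "X \<in> set sp4_basis"
  shows "transpose X ** J4 + J4 ** X = 0"
  using assms unfolding sp4_basis_def list.set
  by (elim insertE emptyE; simp only:; simp add: mat4_expand J4_entries)

lemma sp4_basis_antihermitian:
  assumes "X \<in> set sp4_basis"
  shows "map_matrix cnj X = - transpose X"
  using assms unfolding sp4_basis_def list.set
  by (elim insertE emptyE; simp only:; simp add: mat4_expand)

text \<open>For the trace form the basis is orthogonal with tr X^2 = -4, and it spans the matrices
  with \<open>symp_adj X = - X\<close>. So the sum is -4 tr (P Z), where P = (Y -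
  \<open>symp_adj Y\<close>) / 2 is the projection of Y to that span.\<close>

lemma sp4_completeness_trace:
  "(\<Sum>X\<leftarrow>sp4_basis. trace (X ** Y) * trace (X ** Z)) = 2 * trace (symp_adj Y ** Z) - 2 * trace (Y ** Z)"
  unfolding sp4_basis_def symp_adj_entries
  by (simp add: mat4_expand ii_collect) algebra

text \<open>The same tensor, the sum of all X \<otimes> X, contracted in the other order: -2 tr (Y
  Z) turns into -2 tr Y tr Z, and the term with \<open>symp_adj\<close> changes sign because the
  form is alternating.\<close>

lemma sp4_completeness_sandwich:
  "(\<Sum>X\<leftarrow>sp4_basis. trace (X ** Y ** X ** Z)) = - 2 * trace Y * trace Z - 2 * trace (symp_adj Y ** Z)"
  unfolding sp4_basis_def symp_adj_entries
  by (simp add: mat4_expand ii_collect) algebra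

lemma symp_adj_trace: "trace (symp_adj Y) = trace Y"
  by (simp add: symp_adj_entries mat4_expand)

lemma symp_adj_mult: "symp_adj (Y ** Z) = symp_adj Z ** symp_adj Y"
  by (simp add: symp_adj_entries mat4_expand algebra_simps)

text \<open>\<open>Y + Y\<^sup>#\<close> has characteristic polynomial a square (of the Pfaffian), so it satisfies an equation
  of degree 2 only.\<close>

lemma symp_adj_quadratic:
  "\<exists>p. (Y + symp_adj Y) ** (Y + symp_adj Y) = mat (trace Y) ** (Y + symp_adj Y) - mat p"
proof -
  \<comment> \<open>\<open>Y + symp_adj Y\<close> has the blocks P, b E above c E, transpose P,
    where E = (0, 1; -1, 0) and tr P = \<open>trace Y\<close>. Cayley-Hamilton for P and E^2 = -1
    give p = det P + b c, up to sign the Pfaffian.\<close>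
  define p where "p = (Y$1$1 + Y$3$3) * (Y$2$2 + Y$4$4) - (Y$1$2 + Y$4$3) * (Y$2$1 + Y$3$4)
     - (Y$3$2 - Y$4$1) * (Y$2$3 - Y$1$4)"
  show ?thesis
    by (rule exI[of _ p], simp add: symp_adj_entries mat4_expand p_def) algebra
qed

subsection \<open>The compact symplectic group and its Haar measure\<close>

lemma bounded_bilinear_matrix_mult:
  "bounded_bilinear ((**) :: complex^'n^'m \<Rightarrow> complex^'p^'n \<Rightarrow> complex^'p^'m)"
  unfolding bilinear_conv_bounded_bilinear[symmetric] bilinear_def
  by (auto intro!: linearI simp: matrix_matrix_mult_def vec_eq_iff sum.distrib algebra_simps scaleR_sum_right)

interpretation matrix_mult: bounded_bilinear "(**) :: complex^4^4 \<Rightarrow> complex^4^4 \<Rightarrow> complex^4^4"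
  by (rule bounded_bilinear_matrix_mult)

lemma continuous_on_matrix_mult_left: "continuous_on S (\<lambda>m :: complex^4^4. (g :: complex^4^4) ** m)"
  by (rule matrix_mult.continuous_on[OF continuous_on_const continuous_on_id])

lemma bounded_linear_trace: "bounded_linear (trace :: complex^'n^'n \<Rightarrow> complex)"
  by (auto intro!: linearI simp: linear_conv_bounded_linear[symmetric] trace_def sum.distrib scaleR_sum_right)

lemma transpose_add: "transpose (A + B) = transpose A + transpose B"
  by (simp add: transpose_def vec_eq_iff)

lemma transpose_uminus: "transpose (- A :: complex^'n^'m) = - transpose A"
  by (simp add: transpose_def vec_eq_iff)

lemma USp4_iff:
  "m \<in> USp4 \<longleftrightarrow> transpose m ** J4 ** m = J4 \<and> transpose m ** map_matrix cnj m = mat 1"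
proof -
  have "invertible m" if "transpose m ** map_matrix cnj m = mat 1"
  proof -
    have "transpose (map_matrix cnj m) ** m = mat 1"
      using arg_cong[OF that, of transpose] by (simp add: matrix_transpose_mul)
    then show ?thesis
      using invertible_left_inverse by blast
  qed
  then show ?thesis
    unfolding USp4_def by blast
qed

lemma J4_square: "J4 ** J4 = - mat 1"
  by (simp add: mat4_expand J4_entries)

lemma map_matrix_cnj_mult: "map_matrix cnj (A ** B) = map_matrix cnj A ** map_matrix cnj B"
  by (simp add: vec_eq_iff matrix_matrix_mult_def)

lemma USp4_mult:
  assumes "a \<in> USp4" "b \<in> USp4"
  shows "a ** b \<in> USp4"
proof -
  have "transpose b ** (transpose a ** J4 ** a) ** b = J4"
       "transpose b ** (transpose a ** map_matrix cnj a) ** map_matrix cnj b = mat 1"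
    using assms by (simp_all add: USp4_iff)
  then show ?thesis
    unfolding USp4_iff by (simp add: matrix_transpose_mul map_matrix_cnj_mult matrix_mul_assoc)
qed

text \<open>Since \<open>J4\<close> squares to -1, multiplying the symplectic condition by
  \<open>- J4\<close> on the left exhibits the inverse of \<open>m\<close>.\<close>

lemma USp4_symp_adj:
  assumes "m \<in> USp4"
  shows "symp_adj m ** m = mat 1" "m ** symp_adj m = mat 1"
proof -
  have "symp_adj m ** m = - (J4 ** (transpose m ** J4 ** m))"
    by (simp add: symp_adj_def matrix_mult.minus_left matrix_mul_assoc)
  also have "\<dots> = mat 1"
    using assms by (simp add: USp4_iff J4_square)
  finally show 1: "symp_adj m ** m = mat 1" .
  then show "m ** symp_adj m = mat 1"
    by (simp add: matrix_left_right_inverse)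
qed

lemma USp4_symp_adj_eq_adjoint:
  assumes "m \<in> USp4"
  shows "symp_adj m = transpose (map_matrix cnj m)"
proof -
  have "transpose (transpose m ** map_matrix cnj m) = mat 1"
    using assms by (simp add: USp4_iff)
  then have "transpose (map_matrix cnj m) ** m = mat 1"
    by (simp add: matrix_transpose_mul)
  then show "symp_adj m = transpose (map_matrix cnj m)"
    by (metis USp4_symp_adj(2)[OF assms] matrix_mul_assoc matrix_mul_lid matrix_mul_rid)
qed

text \<open>On the group the symplectic adjoint is the Hermitian adjoint. The former preserves the
  trace, the latter conjugates it.\<close>

lemma USp4_trace_real:
  assumes "m \<in> USp4"
  shows "trace m = of_real (Re (trace m))"
proof -
  have "trace m = cnj (trace m)"
    using symp_adj_trace[of m] USp4_symp_adj_eq_adjoint[OF assms]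
    by (simp add: trace_def transpose_def)
  then show ?thesis
    by (metis Reals_cnj_iff of_real_Re)
qed

text \<open>By unitarity each column is a unit vector. This gives the boundedness needed for
  compactness.\<close>

lemma USp4_norm_entry:
  assumes "m \<in> USp4"
  shows "norm (m $ i $ j) \<le> 1"
proof -
  have "(\<Sum>k\<in>UNIV. (norm (m $ k $ j))\<^sup>2) = 1"
  proof -
    have "(\<Sum>k\<in>UNIV. m $ k $ j * cnj (m $ k $ j)) = 1"
      using assms unfolding USp4_iff
      by (simp add: vec_eq_iff matrix_matrix_mult_def transpose_def mat_def)
    then have "complex_of_real (\<Sum>k\<in>UNIV. (norm (m $ k $ j))\<^sup>2) = 1"
      by (simp add: complex_norm_square del: of_real_power)
    then show ?thesis
      using of_real_eq_1_iff by blast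
  qed
  moreover have "(norm (m $ i $ j))\<^sup>2 \<le> (\<Sum>k\<in>UNIV. (norm (m $ k $ j))\<^sup>2)"
    by (rule member_le_sum) auto
  ultimately show ?thesis
    by (simp add: power_le_one_iff abs_square_le_1)
qed

lemma continuous_on_map_matrix_cnj: "continuous_on S (map_matrix cnj :: complex^'n^'m \<Rightarrow> _)"
  unfolding map_matrix_def by (intro continuous_intros)

lemma continuous_on_transpose: "continuous_on S (transpose :: complex^'n^'m \<Rightarrow> _)"
  unfolding transpose_def by (intro continuous_intros)

lemma compact_USp4: "compact USp4"
proof -
  have "closed USp4"
  proof -
    have "USp4 = {m. transpose m ** J4 ** m = J4} \<inter> {m. transpose m ** map_matrix cnj m = mat 1}"
      by (auto simp: USp4_iff)
    also have "closed \<dots>"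
      by (intro closed_Int closed_Collect_eq continuous_on_const continuous_on_id
           matrix_mult.continuous_on continuous_on_transpose continuous_on_map_matrix_cnj)
    finally show "closed USp4" .
  qed
  moreover have "bounded USp4"
  proof (rule boundedI)
    fix m assume m: "m \<in> USp4"
    have "norm m \<le> (\<Sum>i\<in>UNIV. norm (m $ i))"
      by (simp add: norm_vec_def L2_set_le_sum)
    also have "\<dots> \<le> (\<Sum>i\<in>UNIV. \<Sum>j\<in>UNIV. norm (m $ i $ j))"
      by (intro sum_mono) (simp add: norm_vec_def L2_set_le_sum)
    also have "\<dots> \<le> (\<Sum>i\<in>(UNIV::4 set). \<Sum>j\<in>(UNIV::4 set). 1)"
      by (intro sum_mono USp4_norm_entry[OF m])
    finally show "norm m \<le> 16" by simp
  qed
  ultimately show ?thesis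
    by (simp add: compact_eq_bounded_closed)
qed

section \<open>One-parameter subgroups of the compact symplectic group\<close>

definition sp4_curve :: "complex^4^4 \<Rightarrow> real \<Rightarrow> complex^4^4" where
  "sp4_curve X t = cos t *\<^sub>R mat 1 + sin t *\<^sub>R X"

lemma sp4_curve_in_USp4:
  assumes X: "X \<in> set sp4_basis"
  shows "sp4_curve X t \<in> USp4"
proof -
  note mm = matrix_mult.add_left matrix_mult.add_right matrix_mult.scaleR_left
    matrix_mult.scaleR_right matrix_mult.minus_left matrix_mult.minus_right
    matrix_mult.diff_left matrix_mult.diff_right scaleR_add_right scaleR_diff_right
  have eq: "transpose X ** J4 = - (J4 ** X)"
    using sp4_basis_symplectic[OF X] by (simp add: add_eq_0_iff2)
  have XX: "X ** X = - mat 1" 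
    by (rule sp4_basis_square[OF X])
  have TT: "transpose X ** transpose X = - mat 1"
    using arg_cong[OF XX, of transpose] by (simp add: matrix_transpose_mul transpose_uminus)
  have tr: "transpose (sp4_curve X t) = cos t *\<^sub>R mat 1 + sin t *\<^sub>R transpose X"
    by (simp add: sp4_curve_def transpose_add transpose_scalar)
  have cj: "map_matrix cnj (sp4_curve X t) = cos t *\<^sub>R mat 1 + sin t *\<^sub>R map_matrix cnj X"
    by (simp add: sp4_curve_def vec_eq_iff mat_def)
  have JXX: "J4 ** X ** X = - J4"
    by (simp add: matrix_mul_assoc[symmetric] XX matrix_mult.minus_right)
  \<comment> \<open>By \<open>eq\<close> the mixed terms in cos t sin t cancel, and the coefficient
    of sin^2 t is -J X X = J.\<close>
  have "transpose (sp4_curve X t) ** J4 ** sp4_curve X t = (cos t * cos t) *\<^sub>R J4 + (sin t * sin t) *\<^sub>R J4"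
    unfolding tr unfolding sp4_curve_def
    by (simp add: mm eq JXX)
  moreover have "transpose (sp4_curve X t) ** map_matrix cnj (sp4_curve X t) = (cos t * cos t) *\<^sub>R mat 1 + (sin t * sin t) *\<^sub>R mat 1"
    unfolding tr cj sp4_basis_antihermitian[OF X]
    by (simp add: mm TT)
  ultimately show ?thesis
    by (simp add: USp4_iff scaleR_add_left[symmetric] power2_eq_square[symmetric])
qed

text \<open>As X squares to -1, X (cos t + sin t X) = - sin t + cos t X, which is the derivative of
  the curve.\<close>

lemma sp4_curve_derivative:
  fixes m :: "complex^4^4"
  assumes X: "X \<in> set sp4_basis"
  shows "((\<lambda>t. sp4_curve X t ** m) has_vector_derivative X ** (sp4_curve X t ** m)) (at t)"
proof -
  have "(sp4_curve X has_vector_derivative (- sin t) *\<^sub>R mat 1 + cos t *\<^sub>R X) (at t)"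
    unfolding sp4_curve_def [abs_def]
    by (auto intro!: derivative_eq_intros simp: has_real_derivative_iff_has_vector_derivative[symmetric])
  then have "((\<lambda>t. sp4_curve X t ** m) has_vector_derivative ((- sin t) *\<^sub>R mat 1 + cos t *\<^sub>R X) ** m) (at t)"
    by (rule bounded_linear.has_vector_derivative[OF matrix_mult.bounded_linear_left[of m]])
  moreover have "((- sin t) *\<^sub>R mat 1 + cos t *\<^sub>R X) = X ** sp4_curve X t"
    by (simp add: sp4_curve_def matrix_mult.add_right matrix_mult.scaleR_right sp4_basis_square[OF X])
  ultimately show ?thesis
    by (simp add: matrix_mul_assoc)
qed

section \<open>Haar integration and its infinitesimal invariance\<close>

locale USp4_haar =
  fixes M :: "(complex^4^4) measure"
  assumes haar: "normalized_haar_measure USp4 M"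
begin

lemma sets_M: "sets M = sets (restrict_space borel USp4)"
  using haar by (simp add: normalized_haar_measure_def)

sublocale prob_space M
  using haar by (simp add: normalized_haar_measure_def)

lemma space_M: "space M = USp4"
  using sets_eq_imp_space_eq[OF sets_M] by (simp add: space_restrict_space)

text \<open>The group is compact, so a continuous function is bounded on it, and bounded measurable
  functions are integrable for a probability measure.\<close>

lemma integrable_continuous:
  fixes h :: "complex^4^4 \<Rightarrow> complex"
  assumes "continuous_on UNIV h"
  shows "integrable M h"
proof -
  have "h \<in> borel_measurable M"
    using borel_measurable_continuous_onI[OF assms] measurable_restrict_space1
      measurable_cong_sets[OF sets_M refl] by blast
  moreover have "bounded (h ` USp4)"
    by (intro compact_imp_bounded compact_continuous_image continuous_on_subset[OF assms] compact_USp4) simp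
  then obtain B where "\<And>m. m \<in> USp4 \<Longrightarrow> norm (h m) \<le> B"
    unfolding bounded_iff by auto
  ultimately show ?thesis
    by (intro integrable_const_bound[of h B]) (auto simp: space_M)
qed

lemma integral_translate:
  fixes h :: "complex^4^4 \<Rightarrow> complex"
  assumes "continuous_on UNIV h" and g: "g \<in> USp4"
  shows "(\<integral>m. h (g ** m) \<partial>M) = (\<integral>m. h m \<partial>M)"
proof -
  have "(\<lambda>m :: complex^4^4. g ** m) \<in> borel_measurable borel"
    by (intro borel_measurable_continuous_onI continuous_on_matrix_mult_left)
  then have "(\<lambda>m. g ** m) \<in> restrict_space borel USp4 \<rightarrow>\<^sub>M restrict_space borel USp4"
    by (rule measurable_restrict_space3) (auto intro: USp4_mult[OF g])
  then have meas: "(\<lambda>m. g ** m) \<in> M \<rightarrow>\<^sub>M M"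
    using measurable_cong_sets[OF sets_M sets_M] by blast
  have "(\<integral>m. h m \<partial>M) = (\<integral>m. h m \<partial>(distr M M (\<lambda>m. g ** m)))"
    using haar g by (simp add: normalized_haar_measure_def)
  also have "\<dots> = (\<integral>m. h (g ** m) \<partial>M)"
    using meas integrable_continuous[OF assms(1)] by (intro integral_distr) auto
  finally show ?thesis ..
qed

text \<open>By invariance every difference quotient of \<open>h\<close> along the curve integrates
  to 0. The quotients converge to \<open>D\<close>, and dominated convergence carries the 0 over to
  the limit.\<close>

lemma integral_Lie_derivative:
  fixes h D :: "complex^4^4 \<Rightarrow> complex"
  assumes X: "X \<in> set sp4_basis"
    and h: "continuous_on UNIV h" and D: "continuous_on UNIV D"
    and deriv: "\<And>m t. ((\<lambda>t. h (sp4_curve X t ** m)) has_vector_derivative D (sp4_curve X t ** m)) (at t)"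
  shows "(\<integral>m. D m \<partial>M) = 0"
proof -
  define u where "u n m = real (Suc n) *\<^sub>R (h (sp4_curve X (1 / real (Suc n)) ** m) - h m)" for n m
  have zero: "sp4_curve X 0 ** m = m" for m
    by (simp add: sp4_curve_def)
  have cont_mult: "continuous_on UNIV (\<lambda>m. h (sp4_curve X t ** m))" for t
    by (rule continuous_on_compose2[OF h continuous_on_matrix_mult_left]) auto
  have cont_u: "continuous_on UNIV (u n)" for n
    unfolding u_def by (intro continuous_intros cont_mult h)
  have "bounded (D ` USp4)"
    by (intro compact_imp_bounded compact_continuous_image continuous_on_subset[OF D] compact_USp4) simp
  then obtain C where C: "\<And>m. m \<in> USp4 \<Longrightarrow> norm (D m) \<le> C"
    unfolding bounded_iff by auto
  have bound: "norm (u n m) \<le> C" if m: "m \<in> USp4" for n m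
  proof -
    \<comment> \<open>Mean value inequality: the curve through \<open>m\<close> stays in the group,
      where \<open>C\<close> bounds the derivative. This makes \<open>C\<close> a dominating
      constant, uniform in \<open>n\<close> and \<open>m\<close>.\<close>
    have "norm (h (sp4_curve X (1 / real (Suc n)) ** m) - h (sp4_curve X 0 ** m)) \<le> C * norm (1 / real (Suc n) - 0)"
    proof (rule differentiable_bound[where S = UNIV and f' = "\<lambda>t x. x *\<^sub>R D (sp4_curve X t ** m)"])
      fix t :: real
      show "((\<lambda>t. h (sp4_curve X t ** m)) has_derivative (\<lambda>x. x *\<^sub>R D (sp4_curve X t ** m))) (at t within UNIV)"
        using deriv[of m t] by (simp add: has_vector_derivative_def)
      have "norm (D (sp4_curve X t ** m)) \<le> C"
        by (intro C USp4_mult sp4_curve_in_USp4 X m)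
      moreover have "0 \<le> C"
        by (rule order_trans[OF norm_ge_zero C[OF m]])
      ultimately show "onorm (\<lambda>x. x *\<^sub>R D (sp4_curve X t ** m)) \<le> C"
        by (intro onorm_bound) (simp_all add: mult.commute[of C] mult_left_mono)
    qed auto
    then have "real (Suc n) * norm (h (sp4_curve X (1 / real (Suc n)) ** m) - h m) \<le> C"
      unfolding zero by (simp add: pos_le_divide_eq mult.commute del: of_nat_Suc)
    then show ?thesis
      by (simp add: u_def del: of_nat_Suc)
  qed
  have lim: "(\<lambda>n. u n m) \<longlonglongrightarrow> D m" for m
  proof -
    have "((\<lambda>y. norm (h (sp4_curve X y ** m) - h m - y *\<^sub>R D m) / norm y) \<longlongrightarrow> 0) (at 0)"
      using deriv[of m 0] unfolding has_vector_derivative_def has_derivative_at zero by simp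
    moreover have "filterlim (\<lambda>n. 1 / real (Suc n)) (at 0) sequentially"
      using LIMSEQ_inverse_real_of_nat by (intro filterlim_atI) (auto simp: divide_inverse)
    ultimately have "(\<lambda>n. norm (h (sp4_curve X (1 / real (Suc n)) ** m) - h m - (1 / real (Suc n)) *\<^sub>R D m)
        / norm (1 / real (Suc n))) \<longlonglongrightarrow> 0"
      by (rule filterlim_compose)
    also have "(\<lambda>n. norm (h (sp4_curve X (1 / real (Suc n)) ** m) - h m - (1 / real (Suc n)) *\<^sub>R D m)
        / norm (1 / real (Suc n))) = (\<lambda>n. norm (u n m - D m))"
    proof
      fix n
      have "u n m - D m = real (Suc n) *\<^sub>R (h (sp4_curve X (1 / real (Suc n)) ** m) - h m - (1 / real (Suc n)) *\<^sub>R D m)"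
        unfolding u_def scaleR_diff_right[of "real (Suc n)" _ "(1 / real (Suc n)) *\<^sub>R D m"] by simp
      then show "norm (h (sp4_curve X (1 / real (Suc n)) ** m) - h m - (1 / real (Suc n)) *\<^sub>R D m)
        / norm (1 / real (Suc n)) = norm (u n m - D m)"
        by (simp del: of_nat_Suc)
    qed
    finally show ?thesis
      by (simp add: LIM_zero_iff tendsto_norm_zero_iff)
  qed
  have "(\<lambda>n. \<integral>m. u n m \<partial>M) \<longlonglongrightarrow> (\<integral>m. D m \<partial>M)"
  proof (rule integral_dominated_convergence[where w = "\<lambda>_. C"])
    show "D \<in> borel_measurable M" "u n \<in> borel_measurable M" for n
      by (intro borel_measurable_integrable integrable_continuous D cont_u)+
    show "integrable M (\<lambda>_. C)"
      by simp
    show "AE m in M. (\<lambda>n. u n m) \<longlonglongrightarrow> D m"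
      by (intro AE_I2 lim)
    show "AE m in M. norm (u n m) \<le> C" for n
      by (intro AE_I2 bound) (simp add: space_M)
  qed
  moreover have "(\<integral>m. u n m \<partial>M) = 0" for n
    unfolding u_def
    by (simp add: integral_translate[OF h sp4_curve_in_USp4[OF X]] integrable_continuous h cont_mult)
  ultimately show ?thesis
    by (simp add: LIMSEQ_const_iff)
qed

section \<open>Schwinger-Dyson equations\<close>

text \<open>Integrability is part of the conclusion because the induction step needs it to split the
  integral of a sum.\<close>

lemma integral_sum_list:
  fixes f :: "'b \<Rightarrow> complex^4^4 \<Rightarrow> complex"
  assumes "\<And>x. x \<in> set xs \<Longrightarrow> continuous_on UNIV (f x)"
  shows "(\<integral>m. (\<Sum>x\<leftarrow>xs. f x m) \<partial>M) = (\<Sum>x\<leftarrow>xs. \<integral>m. f x m \<partial>M) \<and> integrable M (\<lambda>m. \<Sum>x\<leftarrow>xs. f x m)"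
  using assms
proof (induction xs)
  case (Cons x xs)
  then have "integrable M (f x)"
    by (intro integrable_continuous) simp
  then show ?case
    using Cons by (simp add: Bochner_Integration.integral_add)
qed simp

text \<open>The integrand is the derivative of \<open>tr (X W(m)) (tr m)\<^sup>a\<close> in the direction \<open>X\<close>, summed over the
  basis; the completeness relation has been applied to the second term.\<close>

lemma Schwinger_Dyson:
  fixes W :: "complex^4^4 \<Rightarrow> complex^4^4" and V :: "complex^4^4 \<Rightarrow> complex^4^4 \<Rightarrow> complex^4^4"
  assumes W: "continuous_on UNIV W" and V: "\<And>X. continuous_on UNIV (V X)"
    and deriv: "\<And>X m t. X \<in> set sp4_basis \<Longrightarrow>
      ((\<lambda>t. W (sp4_curve X t ** m)) has_vector_derivative V X (sp4_curve X t ** m)) (at t)"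
  shows "(\<integral>m. (\<Sum>X\<leftarrow>sp4_basis. trace (X ** V X m)) * trace m ^ a
      + of_nat a * trace m ^ (a - 1) * (2 * trace (symp_adj (W m) ** m) - 2 * trace (W m ** m)) \<partial>M) = 0"
proof -
  \<comment> \<open>The Leibniz derivative of tr (X W(m)) (tr m)^a in the direction X. For
    \<open>a = 0\<close> the truncated exponent \<open>a - 1\<close> is harmless, since the factor
    \<open>of_nat a\<close> vanishes.\<close>
  define D where "D X m = trace (X ** V X m) * trace m ^ a
     + trace (X ** W m) * (of_nat a * trace m ^ (a - 1) * trace (X ** m))" for X m
  note cont = linear_continuous_on[OF bounded_linear_trace]
  have cont_trace: "continuous_on UNIV (\<lambda>m. trace (f m))" if "continuous_on UNIV f" for f :: "complex^4^4 \<Rightarrow> complex^4^4"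
    by (rule continuous_on_compose2[OF cont that]) auto
  have cont_D: "continuous_on UNIV (D X)" for X
    unfolding D_def
    by (intro continuous_intros cont_trace matrix_mult.continuous_on W V)
  have D0: "(\<integral>m. D X m \<partial>M) = 0" if X: "X \<in> set sp4_basis" for X
  proof (rule integral_Lie_derivative[OF X _ cont_D])
    show "continuous_on UNIV (\<lambda>m. trace (X ** W m) * trace m ^ a)"
      by (intro continuous_intros cont_trace matrix_mult.continuous_on W)
    fix m :: "complex^4^4" and t :: real
    define c where "c t = sp4_curve X t ** m" for t
    have "((\<lambda>t. trace (c t)) has_vector_derivative trace (X ** c t)) (at t)"
      unfolding c_def
      by (rule bounded_linear.has_vector_derivative[OF bounded_linear_trace sp4_curve_derivative[OF X]])
    moreover have "((\<lambda>z. z ^ a) has_field_derivative of_nat a * trace (c t) ^ (a - 1)) (at (trace (c t)))"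
      by (auto intro!: derivative_eq_intros)
    ultimately have *: "(((\<lambda>z. z ^ a) \<circ> (\<lambda>t. trace (c t))) has_vector_derivative
        trace (X ** c t) * (of_nat a * trace (c t) ^ (a - 1))) (at t)"
      by (rule field_vector_diff_chain_at)
    have "((\<lambda>t. W (c t)) has_vector_derivative V X (c t)) (at t)"
      unfolding c_def by (rule deriv[OF X])
    then have **: "((\<lambda>t. trace (X ** W (c t))) has_vector_derivative trace (X ** V X (c t))) (at t)"
      by (intro bounded_linear.has_vector_derivative[OF bounded_linear_trace]
          bounded_linear.has_vector_derivative[OF matrix_mult.bounded_linear_right])
    show "((\<lambda>t. trace (X ** W (sp4_curve X t ** m)) * trace (sp4_curve X t ** m) ^ a)
        has_vector_derivative D X (sp4_curve X t ** m)) (at t)"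
      using has_vector_derivative_mult[OF ** *]
      by (simp add: D_def c_def o_def algebra_simps)
  qed
  have "(\<integral>m. (\<Sum>X\<leftarrow>sp4_basis. D X m) \<partial>M) = (\<Sum>X\<leftarrow>sp4_basis. \<integral>m. D X m \<partial>M)"
    using integral_sum_list[of sp4_basis D] cont_D by blast
  also have "\<dots> = (\<Sum>X\<leftarrow>sp4_basis. 0)"
    using D0 by (intro arg_cong[where f = sum_list] map_cong) auto
  finally have "(\<integral>m. (\<Sum>X\<leftarrow>sp4_basis. D X m) \<partial>M) = 0"
    by simp
  moreover have "(\<Sum>X\<leftarrow>sp4_basis. D X m) = (\<Sum>X\<leftarrow>sp4_basis. trace (X ** V X m)) * trace m ^ a
      + of_nat a * trace m ^ (a - 1) * (2 * trace (symp_adj (W m) ** m) - 2 * trace (W m ** m))" for m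
  proof -
    have "(\<Sum>X\<leftarrow>sp4_basis. D X m) = (\<Sum>X\<leftarrow>sp4_basis. trace (X ** V X m) * trace m ^ a)
       + (\<Sum>X\<leftarrow>sp4_basis. (of_nat a * trace m ^ (a - 1)) * (trace (X ** W m) * trace (X ** m)))"
      by (simp add: D_def sum_list_addf mult.left_commute mult.assoc)
    then show ?thesis
      unfolding sum_list_mult_const sum_list_const_mult sp4_completeness_trace by simp
  qed
  ultimately show ?thesis by simp
qed

text \<open>Each of the ten basis elements squares to -1; ten is the dimension of the Lie
  algebra.\<close>

lemma sum_sp4_basis_square: "(\<Sum>X\<leftarrow>sp4_basis. trace (X ** (X ** Y))) = - 10 * trace Y"
proof -
  have "(\<Sum>X\<leftarrow>sp4_basis. trace (X ** (X ** Y))) = (\<Sum>X\<leftarrow>sp4_basis. - trace Y)"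
  proof (intro arg_cong[where f = sum_list] map_cong refl)
    fix X assume "X \<in> set sp4_basis"
    then have "X ** (X ** Y) = - Y"
      by (simp add: matrix_mul_assoc sp4_basis_square matrix_mult.minus_left)
    then show "trace (X ** (X ** Y)) = - trace Y"
      by (simp add: linear_simps[OF bounded_linear_trace])
  qed
  also have "\<dots> = - 10 * trace Y"
    unfolding sum_list_triv by (simp add: sp4_basis_def)
  finally show ?thesis .
qed

text \<open>\<open>Schwinger_Dyson\<close> for W(m) = m, divided by 2. The 4 is the trace of
  \<open>symp_adj m ** m\<close>, the identity.\<close>

lemma integral_Casimir:
  "(\<integral>m. of_nat a * trace m ^ (a - 1) * (4 - trace (m ** m)) - 5 * trace m ^ (a + 1) \<partial>M) = 0"
proof -
  have "(\<integral>m. (\<Sum>X\<leftarrow>sp4_basis. trace (X ** (X ** m))) * trace m ^ a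
      + of_nat a * trace m ^ (a - 1) * (2 * trace (symp_adj m ** m) - 2 * trace (m ** m)) \<partial>M) = 0"
    by (rule Schwinger_Dyson) (auto intro!: sp4_curve_derivative continuous_on_matrix_mult_left)
  also have "(\<integral>m. (\<Sum>X\<leftarrow>sp4_basis. trace (X ** (X ** m))) * trace m ^ a
      + of_nat a * trace m ^ (a - 1) * (2 * trace (symp_adj m ** m) - 2 * trace (m ** m)) \<partial>M)
    = (\<integral>m. 2 * (of_nat a * trace m ^ (a - 1) * (4 - trace (m ** m)) - 5 * trace m ^ (a + 1)) \<partial>M)"
    by (intro Bochner_Integration.integral_cong refl)
      (simp add: sum_sp4_basis_square USp4_symp_adj space_M trace_I algebra_simps)
  finally show ?thesis
    unfolding integral_mult_right_zero by (simp only: mult_eq_0_iff zero_neq_numeral[symmetric] simp_thms)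
qed

text \<open>\<open>Schwinger_Dyson\<close> for W(m) = m^2, divided by 2. The derivative of m^2 has a
  term with X between two factors m, which calls for the sandwich formula.\<close>

lemma integral_Casimir_square:
  "(\<integral>m. of_nat a * trace m ^ (a - 1) * (trace m - trace (m ** m ** m))
      - (5 * trace (m ** m) + (trace m)\<^sup>2 + 4) * trace m ^ a \<partial>M) = 0"
proof -
  have "(\<integral>m. (\<Sum>X\<leftarrow>sp4_basis. trace (X ** (m ** (X ** m) + X ** m ** m))) * trace m ^ a
      + of_nat a * trace m ^ (a - 1) * (2 * trace (symp_adj (m ** m) ** m) - 2 * trace (m ** m ** m)) \<partial>M) = 0"
  proof (rule Schwinger_Dyson)
    show "continuous_on UNIV (\<lambda>m :: complex^4^4. m ** m)"
      by (intro matrix_mult.continuous_on continuous_on_id)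
    show "continuous_on UNIV (\<lambda>m :: complex^4^4. m ** (X ** m) + X ** m ** m)" for X
      by (intro continuous_intros matrix_mult.continuous_on)
  next
    fix X m :: "complex^4^4" and t :: real
    assume X: "X \<in> set sp4_basis"
    show "((\<lambda>t. sp4_curve X t ** m ** (sp4_curve X t ** m)) has_vector_derivative
        sp4_curve X t ** m ** (X ** (sp4_curve X t ** m)) + X ** (sp4_curve X t ** m) ** (sp4_curve X t ** m)) (at t)"
      by (rule matrix_mult.has_vector_derivative[OF sp4_curve_derivative[OF X] sp4_curve_derivative[OF X]])
  qed
  also have "(\<integral>m. (\<Sum>X\<leftarrow>sp4_basis. trace (X ** (m ** (X ** m) + X ** m ** m))) * trace m ^ a
      + of_nat a * trace m ^ (a - 1) * (2 * trace (symp_adj (m ** m) ** m) - 2 * trace (m ** m ** m)) \<partial>M)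
    = (\<integral>m. 2 * (of_nat a * trace m ^ (a - 1) * (trace m - trace (m ** m ** m))
      - (5 * trace (m ** m) + (trace m)\<^sup>2 + 4) * trace m ^ a) \<partial>M)"
  proof (intro Bochner_Integration.integral_cong refl)
    fix m assume "m \<in> space M"
    then have m: "m \<in> USp4" by (simp add: space_M)
    have "symp_adj (m ** m) ** m = symp_adj m ** (symp_adj m ** m)"
      by (simp add: symp_adj_mult matrix_mul_assoc)
    then have 1: "trace (symp_adj (m ** m) ** m) = trace m"
      by (simp add: USp4_symp_adj[OF m] symp_adj_trace)
    have "(\<Sum>X\<leftarrow>sp4_basis. trace (X ** (m ** (X ** m) + X ** m ** m)))
      = (\<Sum>X\<leftarrow>sp4_basis. trace (X ** m ** X ** m) + trace (X ** (X ** (m ** m))))"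
      by (simp add: matrix_add_ldistrib matrix_mul_assoc trace_add)
    \<comment> \<open>The sandwich formula with Y = Z = m gives -2 (tr m)^2 - 8, and the ten squares
      give -10 tr (m^2).\<close>
    also have "\<dots> = - 2 * (trace m)\<^sup>2 - 8 - 10 * trace (m ** m)"
      unfolding sum_list_addf sp4_completeness_sandwich sum_sp4_basis_square
      by (simp add: USp4_symp_adj[OF m] trace_I power2_eq_square)
    finally have 2: "(\<Sum>X\<leftarrow>sp4_basis. trace (X ** (m ** (X ** m) + X ** m ** m))) = - 2 * (trace m)\<^sup>2 - 8 - 10 * trace (m ** m)" .
    show "(\<Sum>X\<leftarrow>sp4_basis. trace (X ** (m ** (X ** m) + X ** m ** m))) * trace m ^ a
      + of_nat a * trace m ^ (a - 1) * (2 * trace (symp_adj (m ** m) ** m) - 2 * trace (m ** m ** m))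
    = 2 * (of_nat a * trace m ^ (a - 1) * (trace m - trace (m ** m ** m))
      - (5 * trace (m ** m) + (trace m)\<^sup>2 + 4) * trace m ^ a)"
      unfolding 1 2 by (simp add: algebra_simps)
  qed
  finally show ?thesis
    unfolding integral_mult_right_zero by (simp only: mult_eq_0_iff zero_neq_numeral[symmetric] simp_thms)
qed

end

text \<open>Newton's identity for \<open>m\<close>, whose characteristic polynomial is palindromic; it is obtained by
  multiplying the quadratic equation of \<open>m + m\<^sup>-\<^sup>1\<close> by \<open>m\<close> and taking traces.\<close>

lemma USp4_trace_cube:
  assumes m: "m \<in> USp4"
  shows "2 * trace (m ** m ** m) = trace m * (3 * trace (m ** m) + 6 - (trace m)\<^sup>2)"
proof -
  define n where "n = symp_adj m"
  have nm: "n ** m = mat 1" "m ** n = mat 1" and tn: "trace n = trace m"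
    using USp4_symp_adj[OF m] by (simp_all add: n_def symp_adj_trace)
  have tnn: "trace (n ** n) = trace (m ** m)"
    by (simp add: n_def symp_adj_trace flip: symp_adj_mult)
  obtain p where p: "(m + n) ** (m + n) = mat (trace m) ** (m + n) - mat p"
    using symp_adj_quadratic[of m] unfolding n_def by blast
  have mat_mult: "trace (mat c ** Y) = c * trace Y" for c and Y :: "complex^4^4"
    by (simp add: mat4_expand algebra_simps)
  have mat_trace: "trace (mat c :: complex^4^4) = 4 * c" for c
    by (simp add: mat4_expand)
  note mm = matrix_mult.add_left matrix_mult.add_right matrix_mult.diff_left trace_add trace_sub
  have sq: "(m + n) ** (m + n) = m ** m + n ** n + mat 2"
    by (simp add: matrix_mult.add_left matrix_mult.add_right nm vec_eq_iff mat_def)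
  \<comment> \<open>The trace of the quadratic equation itself expresses \<open>p\<close> by tr m
    and tr (m^2), so that \<open>p\<close> can be eliminated at the end.\<close>
  have "trace (m ** m + n ** n + mat 2) = trace (mat (trace m) ** (m + n) - mat p)"
    unfolding sq[symmetric] p ..
  then have 1: "2 * trace (m ** m) + 8 = 2 * (trace m)\<^sup>2 - 4 * p"
    by (simp add: trace_add trace_sub mat_mult mat_trace tn tnn power2_eq_square)
  have "trace ((m ** m + n ** n + mat 2) ** m) = trace ((mat (trace m) ** (m + n) - mat p) ** m)"
    unfolding sq[symmetric] p ..
  moreover have "n ** n ** m = n"
    by (simp add: matrix_mul_assoc[symmetric] nm)
  moreover have "trace (mat (trace m) ** (m + n) ** m) = trace m * (trace (m ** m) + 4)"
    by (simp add: matrix_mul_assoc[symmetric] mat_mult mm nm mat_trace distrib_left)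
  ultimately have 2: "trace (m ** m ** m) + 3 * trace m = trace m * (trace (m ** m) + 4) - p * trace m"
    by (simp add: mm mat_mult tn add.commute)
  show ?thesis
    using 1 2 by algebra
qed

section \<open>Moment recurrence for the trace\<close>

context USp4_haar
begin

text \<open>Eliminating the moments of \<open>(tr m)\<^sup>k tr m\<^sup>2\<close> between the two Casimir identities.\<close>

lemma trace_moment_recurrence_complex:
  defines "\<mu> \<equiv> \<lambda>k. \<integral>m. trace m ^ k \<partial>M"
  shows "of_nat ((k + 6) * (k + 8)) * \<mu> (k + 2) = of_nat (16 * (k + 1) * (k + 3)) * \<mu> k" and "\<mu> 1 = 0"
proof -
  define Q where "Q k = (\<integral>m. trace m ^ k * trace (m ** m) \<partial>M)" for k
  note cont = linear_continuous_on[OF bounded_linear_trace]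
  have cont_sq: "continuous_on UNIV (\<lambda>m :: complex^4^4. trace (m ** m))"
    by (rule continuous_on_compose2[OF cont matrix_mult.continuous_on[OF continuous_on_id continuous_on_id]]) auto
  have int: "integrable M (\<lambda>m. trace m ^ k)" "integrable M (\<lambda>m. trace m ^ k * trace (m ** m))" for k
    by (intro integrable_continuous continuous_intros cont cont_sq)+
  \<comment> \<open>At exponent 0 the first Casimir identity reduces to -5 times the first
    moment.\<close>
  show "\<mu> 1 = 0"
    using integral_Casimir[of 0] by (simp add: \<mu>_def)
  have "0 = (\<integral>m. of_nat (k + 1) * (4 * trace m ^ k - trace m ^ k * trace (m ** m)) - 5 * trace m ^ (k + 2) \<partial>M)"
    using integral_Casimir[of "k + 1"] by (simp add: algebra_simps)
  also have "\<dots> = of_nat (k + 1) * (4 * \<mu> k - Q k) - 5 * \<mu> (k + 2)"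
    unfolding \<mu>_def Q_def using int by (simp del: power_Suc add_2_eq_Suc add_2_eq_Suc')
  finally have 1: "0 = of_nat (k + 1) * (4 * \<mu> k - Q k) - 5 * \<mu> (k + 2)" .
  \<comment> \<open>The second Casimir identity at exponent \<open>k\<close>, with the trace of m^3
    replaced by Newton's identity. The case \<open>k = 0\<close> is separate because
    \<open>k - 1\<close> is truncated there.\<close>
  have "0 = (\<integral>m. of_nat k * (trace m ^ (k + 2) / 2 - 3 / 2 * (trace m ^ k * trace (m ** m)) - 2 * trace m ^ k)
     - (5 * (trace m ^ k * trace (m ** m)) + trace m ^ (k + 2) + 4 * trace m ^ k) \<partial>M)"
  proof -
    have "of_nat k * trace m ^ (k - 1) * (trace m - trace (m ** m ** m)) - (5 * trace (m ** m) + (trace m)\<^sup>2 + 4) * trace m ^ k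
      = of_nat k * (trace m ^ (k + 2) / 2 - 3 / 2 * (trace m ^ k * trace (m ** m)) - 2 * trace m ^ k)
     - (5 * (trace m ^ k * trace (m ** m)) + trace m ^ (k + 2) + 4 * trace m ^ k)" if m: "m \<in> USp4" for m
    proof -
      have c: "trace (m ** m ** m) = trace m * (3 * trace (m ** m) + 6 - (trace m)\<^sup>2) / 2"
        using USp4_trace_cube[OF m] by (simp add: field_simps)
      show ?thesis
        by (cases k) (simp_all add: c field_simps power2_eq_square)
    qed
    then show ?thesis
      unfolding integral_Casimir_square[of k, symmetric]
      by (intro Bochner_Integration.integral_cong) (simp_all add: space_M)
  qed
  also have "\<dots> = of_nat k * (\<mu> (k + 2) / 2 - 3 / 2 * Q k - 2 * \<mu> k) - (5 * Q k + \<mu> (k + 2) + 4 * \<mu> k)"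
    unfolding \<mu>_def Q_def using int by (simp del: power_Suc add_2_eq_Suc add_2_eq_Suc')
  finally have 2: "0 = of_nat k * (\<mu> (k + 2) / 2 - 3 / 2 * Q k - 2 * \<mu> k) - (5 * Q k + \<mu> (k + 2) + 4 * \<mu> k)" .
  define x where "x = (of_nat k :: complex)"
  have "(x + 1) * (4 * \<mu> k - Q k) - 5 * \<mu> (k + 2) = 0"
    using 1 by (simp add: x_def add.commute)
  moreover have "x * (\<mu> (k + 2) - 3 * Q k - 4 * \<mu> k) - 2 * (5 * Q k + \<mu> (k + 2) + 4 * \<mu> k) = 0"
    using 2 by (simp add: x_def field_simps)
  \<comment> \<open>Both relations are linear in \<open>Q k\<close>, with coefficients -(x + 1) and
    -(3 x + 10). Cross-multiplying removes it, and x^2 + 14 x + 48 = (x + 6) (x + 8).\<close>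
  ultimately have "(x + 6) * (x + 8) * \<mu> (k + 2) = 16 * (x + 1) * (x + 3) * \<mu> k"
    by algebra
  then show "of_nat ((k + 6) * (k + 8)) * \<mu> (k + 2) = of_nat (16 * (k + 1) * (k + 3)) * \<mu> k"
    by (simp add: x_def algebra_simps)
qed

text \<open>The trace is real on the group, so the complex moments are the embedded real
  ones.\<close>

lemma trace_moment_recurrence:
  defines "\<mu> \<equiv> \<lambda>k. \<integral>m. Re (trace m) ^ k \<partial>M"
  shows "real ((k + 6) * (k + 8)) * \<mu> (k + 2) = real (16 * (k + 1) * (k + 3)) * \<mu> k"
    and "\<mu> 1 = 0" and "\<mu> 0 = 1"
proof -
  have eq: "(\<integral>m. trace m ^ k \<partial>M) = complex_of_real (\<mu> k)" for k
  proof -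
    have "(\<integral>m. trace m ^ k \<partial>M) = (\<integral>m. complex_of_real (Re (trace m) ^ k) \<partial>M)"
      by (intro Bochner_Integration.integral_cong refl) (metis USp4_trace_real of_real_power space_M)
    then show ?thesis
      by (simp add: \<mu>_def del: of_real_power)
  qed
  have "complex_of_real (real ((k + 6) * (k + 8)) * \<mu> (k + 2)) = complex_of_real (real (16 * (k + 1) * (k + 3)) * \<mu> k)"
    using trace_moment_recurrence_complex(1)[of k] unfolding eq by simp
  then show "real ((k + 6) * (k + 8)) * \<mu> (k + 2) = real (16 * (k + 1) * (k + 3)) * \<mu> k"
    unfolding of_real_eq_iff .
  show "\<mu> 1 = 0"
    using trace_moment_recurrence_complex(2) unfolding eq by simp
  show "\<mu> 0 = 1"
    by (simp add: \<mu>_def prob_space)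
qed

end

subsection \<open>Gauss' summation theorem\<close>

definition gauss_term :: "real \<Rightarrow> real \<Rightarrow> real \<Rightarrow> nat \<Rightarrow> real" where
  "gauss_term a b c n = pochhammer a n * pochhammer b n / (pochhammer c n * fact n)"

lemma hyp2F1_altdef: "hyp2F1 a b c z = (\<Sum>n. gauss_term a b c n * z ^ n)"
  by (simp add: hyp2F1_def gauss_term_def)

lemma gauss_term_nonneg: "a > 0 \<Longrightarrow> b > 0 \<Longrightarrow> c > 0 \<Longrightarrow> gauss_term a b c n \<ge> 0"
  by (simp add: gauss_term_def pochhammer_pos less_imp_le)

lemma gauss_term_0 [simp]: "gauss_term a b c 0 = 1"
  by (simp add: gauss_term_def)

lemma gauss_term_Suc:
  assumes "c > 0"
  shows "gauss_term a b c (Suc n) * ((c + real n) * (real n + 1)) = gauss_term a b c n * ((a + real n) * (b + real n))"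
proof -
  define k where "k = real n + 1"
  have "fact (Suc n) = k * fact n" "k > 0" "pochhammer c n > 0" "c + real n > 0"
    using assms by (auto simp: k_def intro: pochhammer_pos)
  then show ?thesis
    unfolding gauss_term_def pochhammer_Suc k_def[symmetric] by (simp add: mult_ac)
qed

lemma gauss_term_shift:
  assumes "c > 0"
  shows "gauss_term a b (c + 1) n * (c + real n) = gauss_term a b c n * c"
proof -
  have "c * pochhammer (c + 1) n = pochhammer c n * (c + real n)"
    using pochhammer_rec[of c n] pochhammer_Suc[of c n] by simp
  then have eq: "pochhammer (c + 1) n = pochhammer c n * (c + real n) / c"
    using assms by (simp add: field_simps)
  show ?thesis
    unfolding gauss_term_def eq using assms pochhammer_pos[OF assms, of n] by simp
qed

text \<open>Euler's limit for Gamma gives (z)_n ~ (n - 1)! n^z / Gamma z; it is applied to each of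
  the Pochhammer symbols.\<close>

lemma gauss_term_asymptotics:
  assumes "a > 0" "b > 0" "c > 0"
  shows "(\<lambda>n. gauss_term a b c n * real n powr (c + 1 - a - b)) \<longlonglongrightarrow> Gamma c / (Gamma a * Gamma b)"
proof -
  have "(\<lambda>n. Gamma_series' c n / (Gamma_series' a n * Gamma_series' b n)) \<longlonglongrightarrow> Gamma c / (Gamma a * Gamma b)"
    using assms by (intro tendsto_intros Gamma_series'_LIMSEQ) (simp add: less_imp_neq[OF Gamma_real_pos, symmetric])
  moreover have "Gamma_series' c n / (Gamma_series' a n * Gamma_series' b n) = gauss_term a b c n * real n powr (c + 1 - a - b)"
    if n: "n > 0" for n
  proof -
    have pw: "real n powr (c + 1 - a - b) = real n * (real n powr c / (real n powr a * real n powr b))"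
      using n by (simp add: powr_diff powr_add)
    have fact: "fact n = real n * fact (n - 1)"
      using n by (rule fact_reduce)
    have "Gamma_series' z n = fact (n - 1) * real n powr z / pochhammer z n" for z :: real
      using n by (simp add: Gamma_series'_def powr_def)
    then show ?thesis
      unfolding gauss_term_def pw fact using n by (simp add: mult_ac)
  qed
  ultimately show ?thesis
    by (rule Lim_transform_eventually[OF _ eventually_mono[OF eventually_gt_at_top[of 0]]])
qed

text \<open>The terms are O(n^(a + b - c - 1)), and this exponent is below -1.\<close>

lemma summable_gauss_term:
  assumes "a > 0" "b > 0" "c > a + b"
  shows "summable (gauss_term a b c)"
proof -
  have summ: "summable (\<lambda>n. real n powr (a + b - c - 1))"
    using assms by (simp add: summable_real_powr_iff)
  have "eventually (\<lambda>n. gauss_term a b c n * real n powr (c + 1 - a - b) < Gamma c / (Gamma a * Gamma b) + 1) sequentially"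
    using assms by (intro order_tendstoD(2)[OF gauss_term_asymptotics]) auto
  then have "eventually (\<lambda>n. norm (gauss_term a b c n) \<le> (Gamma c / (Gamma a * Gamma b) + 1) * real n powr (a + b - c - 1)) sequentially"
    using eventually_gt_at_top[of 0]
  proof eventually_elim
    case (elim n)
    have "gauss_term a b c n = gauss_term a b c n * real n powr (c + 1 - a - b) * real n powr (a + b - c - 1)"
      using elim by (simp add: powr_add[symmetric])
    also have "\<dots> \<le> (Gamma c / (Gamma a * Gamma b) + 1) * real n powr (a + b - c - 1)"
      using elim by (intro mult_right_mono) auto
    finally show ?case
      using gauss_term_nonneg[of a b c n] assms by simp
  qed
  then show ?thesis
    by (rule summable_comparison_test_ev[OF _ summable_mult[OF summ]])
qed

text \<open>The product is of order n^(a + b - c), a negative power. It is the boundary term of the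
  telescoping sum that follows.\<close>

lemma gauss_term_weighted_tendsto_0:
  assumes "a > 0" "b > 0" "c > a + b"
  shows "(\<lambda>n. real n * gauss_term a b c n) \<longlonglongrightarrow> 0"
proof -
  have "(\<lambda>n. real n powr (a + b - c)) \<longlonglongrightarrow> 0"
    using assms by (intro tendsto_neg_powr filterlim_real_sequentially) auto
  then have "(\<lambda>n. gauss_term a b c n * real n powr (c + 1 - a - b) * real n powr (a + b - c)) \<longlonglongrightarrow> Gamma c / (Gamma a * Gamma b) * 0"
    using assms by (intro tendsto_mult gauss_term_asymptotics) auto
  moreover have "gauss_term a b c n * real n powr (c + 1 - a - b) * real n powr (a + b - c) = real n * gauss_term a b c n"
    if "n > 0" for n
    using that by (simp add: mult.assoc powr_add[symmetric])
  ultimately have "(\<lambda>n. real n * gauss_term a b c n) \<longlonglongrightarrow> Gamma c / (Gamma a * Gamma b) * 0"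
    by (rule Lim_transform_eventually[OF _ eventually_mono[OF eventually_gt_at_top[of 0]]])
  then show ?thesis
    by simp
qed

text \<open>Telescoping: the difference of the two sides is, term by term, \<open>U (n + 1) - U n\<close> with
  \<open>U n = c n t\<^sub>n\<close>, where \<open>t\<^sub>n\<close> is the general term.\<close>

lemma gauss_sum_contiguous:
  assumes "a > 0" "b > 0" "c > a + b"
  shows "c * (c - a - b) * (\<Sum>n. gauss_term a b c n) = (c - a) * (c - b) * (\<Sum>n. gauss_term a b (c + 1) n)"
proof -
  have c: "c > 0" using assms by simp
  define U where "U n = c * (real n * gauss_term a b c n)" for n
  have "U \<longlonglongrightarrow> c * 0"
    unfolding U_def using assms by (intro tendsto_intros gauss_term_weighted_tendsto_0)
  then have "(\<lambda>n. U (Suc n) - U n) sums (0 - U 0)"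
    by (intro telescope_sums) simp
  then have sums1: "(\<lambda>n. U (Suc n) - U n) sums 0"
    by (simp add: U_def)
  have sums2: "(\<lambda>n. (c - a) * (c - b) * gauss_term a b (c + 1) n - c * (c - a - b) * gauss_term a b c n) sums
      ((c - a) * (c - b) * (\<Sum>n. gauss_term a b (c + 1) n) - c * (c - a - b) * (\<Sum>n. gauss_term a b c n))"
    using assms by (intro sums_diff sums_mult summable_sums summable_gauss_term) auto
  have "U (Suc n) - U n = (c - a) * (c - b) * gauss_term a b (c + 1) n - c * (c - a - b) * gauss_term a b c n" for n
  proof -
    define t where "t = gauss_term a b c n"
    have cn: "c + real n > 0" using c by simp
    have 1: "gauss_term a b c (Suc n) * (real n + 1) = t * ((a + real n) * (b + real n)) / (c + real n)"
      using gauss_term_Suc[OF c, of a b n] cn by (simp add: t_def field_simps)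
    have 2: "gauss_term a b (c + 1) n = t * c / (c + real n)"
      using gauss_term_shift[OF c, of a b n] cn by (simp add: t_def field_simps)
    have "U (Suc n) - U n = c * (gauss_term a b c (Suc n) * (real n + 1)) - c * (real n * t)"
      by (simp add: U_def t_def algebra_simps)
    also have "\<dots> = (c - a) * (c - b) * (t * c / (c + real n)) - c * (c - a - b) * t"
      unfolding 1 using cn by (simp add: divide_simps) (simp add: algebra_simps)
    finally show ?thesis
      unfolding 2 t_def .
  qed
  then have "0 = (c - a) * (c - b) * (\<Sum>n. gauss_term a b (c + 1) n) - c * (c - a - b) * (\<Sum>n. gauss_term a b c n)"
    by (intro sums_unique2[OF sums1]) (simp only: sums2)
  then show ?thesis
    by simp
qed

text \<open>Applying the contiguous relation at c, c + 1, ..., c + n - 1 collects its factors into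
  Pochhammer symbols.\<close>

lemma gauss_sum_iterated:
  assumes "a > 0" "b > 0" "c > a + b"
  shows "pochhammer c n * pochhammer (c - a - b) n * (\<Sum>j. gauss_term a b c j)
    = pochhammer (c - a) n * pochhammer (c - b) n * (\<Sum>j. gauss_term a b (c + real n) j)"
proof (induction n)
  case (Suc n)
  define S where "S m = (\<Sum>j. gauss_term a b (c + real m) j)" for m
  have step: "(c + real n) * (c + real n - a - b) * S n = (c + real n - a) * (c + real n - b) * S (Suc n)"
    using gauss_sum_contiguous[of a b "c + real n"] assms by (simp add: S_def add.assoc add.commute[of 1])
  have "pochhammer c (Suc n) * pochhammer (c - a - b) (Suc n) * (\<Sum>j. gauss_term a b c j)
    = (c + real n) * (c - a - b + real n) * (pochhammer c n * pochhammer (c - a - b) n * (\<Sum>j. gauss_term a b c j))"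
    by (simp add: pochhammer_Suc)
  also have "\<dots> = pochhammer (c - a) n * pochhammer (c - b) n * ((c + real n) * (c + real n - a - b) * S n)"
    unfolding Suc.IH S_def by (simp add: algebra_simps)
  also have "\<dots> = pochhammer (c - a) (Suc n) * pochhammer (c - b) (Suc n) * S (Suc n)"
    unfolding step by (simp add: pochhammer_Suc algebra_simps)
  finally show ?case
    by (simp only: S_def)
qed simp

text \<open>The term of index 0 is 1, and each later term is at most c / (c + n) times the
  corresponding term for the parameter c, whose series converges.\<close>

lemma gauss_sum_shift_tendsto_1:
  assumes "a > 0" "b > 0" "c > a + b"
  shows "(\<lambda>n. \<Sum>j. gauss_term a b (c + real n) j) \<longlonglongrightarrow> 1"
proof -
  have c: "c > 0" using assms by simp
  have aux: "1 / P' \<le> c / m * (1 / P)" if "P * m \<le> c * P'" "m > 0" "P > 0" "P' > 0" for P P' m :: real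
    using that by (simp add: field_simps)
  define R where "R = (\<Sum>j. gauss_term a b c (Suc j))"
  have bounds: "1 \<le> (\<Sum>j. gauss_term a b (c + real n) j) \<and> (\<Sum>j. gauss_term a b (c + real n) j) \<le> 1 + c / (c + real n) * R" for n
  proof -
    have summ: "summable (gauss_term a b (c + real n))" "summable (gauss_term a b c)"
      using assms by (auto intro!: summable_gauss_term)
    have split: "(\<Sum>j. gauss_term a b (c + real n) j) = 1 + (\<Sum>j. gauss_term a b (c + real n) (Suc j))"
      using suminf_split_head[OF summ(1)] by simp
    have le: "gauss_term a b (c + real n) (Suc j) \<le> c / (c + real n) * gauss_term a b c (Suc j)" for j
    proof -
      \<comment> \<open>Split off the first factors, c on the left and c + n on the right; the
        remaining factors compare one by one.\<close>
      have "pochhammer c (Suc j) * (c + real n) \<le> c * pochhammer (c + real n) (Suc j)"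
      proof -
        have "pochhammer (c + 1) j \<le> pochhammer (c + real n + 1) j"
          using c unfolding pochhammer_prod by (intro prod_mono) auto
        then have "(c * (c + real n)) * pochhammer (c + 1) j \<le> (c * (c + real n)) * pochhammer (c + real n + 1) j"
          using c by (intro mult_left_mono) auto
        then show ?thesis
          by (simp add: pochhammer_rec mult_ac)
      qed
      then have "1 / pochhammer (c + real n) (Suc j) \<le> c / (c + real n) * (1 / pochhammer c (Suc j))"
        by (rule aux) (use c in \<open>simp_all only: pochhammer_pos add_pos_nonneg of_nat_0_le_iff\<close>)
      moreover define w where "w = pochhammer a (Suc j) * pochhammer b (Suc j) / fact (Suc j)"
      moreover have "w \<ge> 0"
        unfolding w_def using assms(1,2) by (intro divide_nonneg_pos mult_nonneg_nonneg less_imp_le[OF pochhammer_pos] fact_gt_zero)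
      ultimately have "w * (1 / pochhammer (c + real n) (Suc j)) \<le> w * (c / (c + real n) * (1 / pochhammer c (Suc j)))"
        by (intro mult_left_mono)
      moreover have "gauss_term a b d (Suc j) = w * (1 / pochhammer d (Suc j))" for d
        unfolding gauss_term_def w_def by (simp only: divide_divide_eq_left mult_1_right times_divide_eq_right mult.commute[of _ "fact (Suc j)"])
      ultimately show ?thesis
        by (simp only: mult.left_commute)
    qed
    have summ': "summable (\<lambda>j. gauss_term a b (c + real n) (Suc j))" "summable (\<lambda>j. gauss_term a b c (Suc j))"
      using summ by (simp_all add: summable_Suc_iff)
    have "(\<Sum>j. gauss_term a b (c + real n) (Suc j)) \<le> (\<Sum>j. c / (c + real n) * gauss_term a b c (Suc j))"
      by (intro suminf_le le summ' summable_mult)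
    also have "\<dots> = c / (c + real n) * R"
      unfolding R_def by (rule suminf_mult[OF summ'(2)])
    finally have "(\<Sum>j. gauss_term a b (c + real n) (Suc j)) \<le> c / (c + real n) * R" .
    moreover have "0 \<le> (\<Sum>j. gauss_term a b (c + real n) (Suc j))"
      using assms by (intro suminf_nonneg summ' gauss_term_nonneg) auto
    ultimately show ?thesis
      unfolding split by simp
  qed
  have "(\<lambda>n. 1 + c / (c + real n) * R) \<longlonglongrightarrow> 1 + 0 * R"
    by (intro tendsto_intros tendsto_divide_0[OF tendsto_const] filterlim_at_top_imp_at_infinity
          filterlim_tendsto_add_at_top[OF tendsto_const filterlim_real_sequentially])
  then have lim: "(\<lambda>n. 1 + c / (c + real n) * R) \<longlonglongrightarrow> 1"
    by simp
  show ?thesis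
    by (rule tendsto_sandwich[OF _ _ tendsto_const lim]; rule always_eventually) (blast intro: bounds[THEN conjunct1] bounds[THEN conjunct2])+
qed

text \<open>Let n tend to infinity in \<open>gauss_sum_iterated\<close>: the shifted sum tends to 1,
  and the quotient of Pochhammer symbols is a quotient of Gamma series.\<close>

theorem gauss_summation:
  assumes "a > 0" "b > 0" "c > a + b"
  shows "gauss_term a b c sums (Gamma c * Gamma (c - a - b) / (Gamma (c - a) * Gamma (c - b)))"
proof -
  define S where "S = (\<Sum>j. gauss_term a b c j)"
  \<comment> \<open>\<open>Gamma_series z n\<close> divides by \<open>pochhammer z (n + 1)\<close>,
    hence the shift by n + 1 in the sum.\<close>
  have "(\<lambda>n. Gamma_series c n * Gamma_series (c - a - b) n / (Gamma_series (c - a) n * Gamma_series (c - b) n)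
      * (\<Sum>j. gauss_term a b (c + real (n + 1)) j)) \<longlonglongrightarrow> Gamma c * Gamma (c - a - b) / (Gamma (c - a) * Gamma (c - b)) * 1"
    using assms
    by (intro tendsto_intros LIMSEQ_ignore_initial_segment[OF gauss_sum_shift_tendsto_1])
      (simp_all add: less_imp_neq[OF Gamma_real_pos, symmetric])
  moreover have "Gamma_series c n * Gamma_series (c - a - b) n / (Gamma_series (c - a) n * Gamma_series (c - b) n)
      * (\<Sum>j. gauss_term a b (c + real (n + 1)) j) = S" for n
  proof -
    have pos: "pochhammer c (n+1) > 0" "pochhammer (c-a-b) (n+1) > 0" "pochhammer (c-a) (n+1) > 0" "pochhammer (c-b) (n+1) > 0"
      using assms by (auto intro!: pochhammer_pos)
    \<comment> \<open>Both sides have total exponent 2 c - a - b, so the powers of n cancel in the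
      quotient.\<close>
    have e: "exp (c * ln (real n)) * exp ((c - a - b) * ln (real n)) = exp ((c - a) * ln (real n)) * exp ((c - b) * ln (real n))"
      by (simp add: exp_add[symmetric] algebra_simps)
    have "Gamma_series c n * Gamma_series (c - a - b) n / (Gamma_series (c - a) n * Gamma_series (c - b) n)
      = (fact n * fact n * (exp (c * ln (real n)) * exp ((c - a - b) * ln (real n)))) / (pochhammer c (n+1) * pochhammer (c-a-b) (n+1))
        / ((fact n * fact n * (exp ((c - a) * ln (real n)) * exp ((c - b) * ln (real n)))) / (pochhammer (c-a) (n+1) * pochhammer (c-b) (n+1)))"
      by (simp add: Gamma_series_def mult_ac)
    also have "\<dots> = pochhammer (c-a) (n+1) * pochhammer (c-b) (n+1) / (pochhammer c (n+1) * pochhammer (c-a-b) (n+1))"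
      unfolding e by simp
    finally have 1: "Gamma_series c n * Gamma_series (c - a - b) n / (Gamma_series (c - a) n * Gamma_series (c - b) n)
      = pochhammer (c-a) (n+1) * pochhammer (c-b) (n+1) / (pochhammer c (n+1) * pochhammer (c-a-b) (n+1))" .
    show ?thesis
      unfolding 1 times_divide_eq_left gauss_sum_iterated[OF assms, of "n + 1", symmetric] S_def
      using pos by simp
  qed
  ultimately have "S = Gamma c * Gamma (c - a - b) / (Gamma (c - a) * Gamma (c - b))"
    by (simp add: LIMSEQ_const_iff)
  then show ?thesis
    using summable_sums[OF summable_gauss_term[OF assms]] by (simp add: S_def)
qed

subsection \<open>Moments of the hypergeometric density\<close>

definition USp4_trace_density :: "real \<Rightarrow> real" where
  "USp4_trace_density x = 1 / (4 * pi) * (1 - x\<^sup>2 / 16) ^ 4 * hyp2F1 (3/2) (5/2) 5 (1 - x\<^sup>2 / 16)"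

lemma one_minus_square_bounds:
  fixes x :: real
  assumes "x \<in> {-4..4}"
  shows "1 - x\<^sup>2 / 16 \<in> {0..1}"
proof -
  have "\<bar>x\<bar>\<^sup>2 \<le> 4\<^sup>2"
    using assms by (intro power_mono) auto
  then show ?thesis by simp
qed

text \<open>On [0, 1] every term is dominated by its value at z = 1, and those values are
  summable.\<close>

lemma uniform_limit_hyp2F1:
  assumes "a > 0" "b > 0" "c > a + b"
  shows "uniform_limit {0..1} (\<lambda>N z. \<Sum>n<N. gauss_term a b c n * z ^ n) (hyp2F1 a b c) sequentially"
  unfolding hyp2F1_altdef[abs_def]
proof (rule Weierstrass_m_test)
  show "summable (gauss_term a b c)"
    using assms by (rule summable_gauss_term)
  fix n and z :: real
  assume "z \<in> {0..1}"
  then show "norm (gauss_term a b c n * z ^ n) \<le> gauss_term a b c n"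
    using gauss_term_nonneg[of a b c n] assms by (simp add: abs_mult mult_left_le power_le_one)
qed

lemma continuous_on_hyp2F1:
  assumes "a > 0" "b > 0" "c > a + b"
  shows "continuous_on {0..1} (hyp2F1 a b c)"
  by (rule uniform_limit_theorem[OF _ uniform_limit_hyp2F1[OF assms]])
    (auto intro!: always_eventually continuous_intros)

lemma continuous_on_hyp2F1_trace:
  "continuous_on {-4..4} (\<lambda>x :: real. hyp2F1 (3/2) (5/2) 5 (1 - x\<^sup>2 / 16))"
  by (rule continuous_on_compose2[OF continuous_on_hyp2F1])
    (use one_minus_square_bounds in \<open>auto intro!: continuous_intros\<close>)

lemma continuous_on_USp4_trace_density: "continuous_on {-4..4} USp4_trace_density"
  unfolding USp4_trace_density_def by (intro continuous_intros continuous_on_hyp2F1_trace) auto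

text \<open>The substitution x^2 = 16 t shows this to be 4^(2 n + 1) times the Beta value B(n + 1/2,
  j + 1). The induction multiplies out one factor 1 - x^2 / 16, which relates j + 1 at n to j at n
  and n + 1.\<close>

lemma has_integral_even_moment:
  "((\<lambda>x. x ^ (2 * n) * (1 - x\<^sup>2 / 16) ^ j) has_integral
     4 ^ (2 * n + 1) * fact j / pochhammer (real n + 1 / 2) (j + 1)) {-4..4::real}"
proof (induction j arbitrary: n)
  case 0
  have "((\<lambda>x. x ^ (2 * n)) has_integral 4 ^ (2 * n + 1) / real (2 * n + 1) - (-4) ^ (2 * n + 1) / real (2 * n + 1)) {-4..4::real}"
    by (rule fundamental_theorem_of_calculus)
      (auto intro!: derivative_eq_intros simp: has_real_derivative_iff_has_vector_derivative[symmetric] simp del: power_Suc)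
  moreover have "4 ^ (2 * n + 1) / real (2 * n + 1) - (-4) ^ (2 * n + 1) / real (2 * n + 1) = 4 ^ (2 * n + 1) / (real n + 1 / 2)"
    by (simp add: divide_simps)
  ultimately show ?case
    by (simp only: power_0 mult_1_right fact_0 add_0 pochhammer_1 One_nat_def[symmetric])
next
  case (Suc j)
  define p where "p = pochhammer (real n + 3 / 2) j"
  have pos: "p > 0" "real n + 1 / 2 > 0" "real n + 1 / 2 + (real j + 1) > 0"
    unfolding p_def by (auto intro!: pochhammer_pos)
  have p: "pochhammer (real n + 1 / 2) (j + 1) = (real n + 1 / 2) * p"
    "pochhammer (real (n + 1) + 1 / 2) (j + 1) = p * (real n + 1 / 2 + (real j + 1))"
    "pochhammer (real n + 1 / 2) (Suc j + 1) = (real n + 1 / 2) * p * (real n + 1 / 2 + (real j + 1))"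
  proof -
    have r: "real n + 1 / 2 + 1 = real n + 3 / 2" "real (n + 1) + 1 / 2 = real n + 3 / 2"
      by simp_all
    show p1: "pochhammer (real n + 1 / 2) (j + 1) = (real n + 1 / 2) * p"
      using pochhammer_rec[of "real n + 1 / 2" j] unfolding r p_def by simp
    show p2: "pochhammer (real (n + 1) + 1 / 2) (j + 1) = p * (real n + 1 / 2 + (real j + 1))"
      using pochhammer_Suc[of "real n + 3 / 2" j] unfolding r p_def by (simp add: algebra_simps)
    show "pochhammer (real n + 1 / 2) (Suc j + 1) = (real n + 1 / 2) * p * (real n + 1 / 2 + (real j + 1))"
      using pochhammer_rec[of "real n + 1 / 2" "Suc j"] p2 unfolding r by (simp add: mult.assoc)
  qed
  have "((\<lambda>x. x ^ (2 * n) * (1 - x\<^sup>2 / 16) ^ j - 1 / 16 * (x ^ (2 * (n + 1)) * (1 - x\<^sup>2 / 16) ^ j)) has_integral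
      4 ^ (2 * n + 1) * fact j / pochhammer (real n + 1 / 2) (j + 1)
      - 1 / 16 * (4 ^ (2 * (n + 1) + 1) * fact j / pochhammer (real (n + 1) + 1 / 2) (j + 1))) {-4..4}"
    by (intro has_integral_diff has_integral_mult_right Suc.IH)
  also have "(\<lambda>x::real. x ^ (2 * n) * (1 - x\<^sup>2 / 16) ^ j - 1 / 16 * (x ^ (2 * (n + 1)) * (1 - x\<^sup>2 / 16) ^ j))
      = (\<lambda>x. x ^ (2 * n) * (1 - x\<^sup>2 / 16) ^ Suc j)"
    by (simp add: fun_eq_iff algebra_simps power2_eq_square)
  also have "4 ^ (2 * n + 1) * fact j / pochhammer (real n + 1 / 2) (j + 1)
      - 1 / 16 * (4 ^ (2 * (n + 1) + 1) * fact j / pochhammer (real (n + 1) + 1 / 2) (j + 1))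
      = 4 ^ (2 * n + 1) * fact (Suc j) / pochhammer (real n + 1 / 2) (Suc j + 1)"
  proof -
    define r where "r = real n + 1 / 2"
    define s where "s = r + (real j + 1)"
    have rs: "r > 0" "s > 0"
      using pos by (simp_all add: r_def s_def)
    \<comment> \<open>Partial fractions: s - r = j + 1, the factor that turns \<open>fact j\<close>
      into \<open>fact (Suc j)\<close>.\<close>
    have "1 / (r * p) - 1 / (p * s) = (real j + 1) / (r * p * s)"
      using pos(1) rs by (simp add: divide_simps) (simp add: s_def algebra_simps)
    then have "4 ^ (2 * n + 1) * fact j * (1 / (r * p) - 1 / (p * s)) = 4 ^ (2 * n + 1) * fact j * ((real j + 1) / (r * p * s))"
      by simp
    then show ?thesis
      unfolding p unfolding r_def[symmetric] s_def[symmetric] by (simp add: algebra_simps)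
  qed
  finally show ?case .
qed

lemma has_integral_odd_moment:
  assumes "odd k"
  shows "((\<lambda>x. x ^ k * (1 - x\<^sup>2 / 16) ^ j) has_integral 0) {-4..4::real}"
  using assms
proof (induction j arbitrary: k)
  case 0
  have "((\<lambda>x. x ^ k) has_integral 4 ^ (k + 1) / real (k + 1) - (-4) ^ (k + 1) / real (k + 1)) {-4..4::real}"
    by (rule fundamental_theorem_of_calculus)
      (auto intro!: derivative_eq_intros simp: has_real_derivative_iff_has_vector_derivative[symmetric] simp del: power_Suc)
  then show ?case
    using 0 by simp
next
  case (Suc j)
  have "((\<lambda>x. x ^ k * (1 - x\<^sup>2 / 16) ^ j - 1 / 16 * (x ^ (k + 2) * (1 - x\<^sup>2 / 16) ^ j)) has_integral 0 - 1 / 16 * 0) {-4..4::real}"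
    using Suc.prems by (intro has_integral_diff has_integral_mult_right Suc.IH) auto
  also have "(\<lambda>x::real. x ^ k * (1 - x\<^sup>2 / 16) ^ j - 1 / 16 * (x ^ (k + 2) * (1 - x\<^sup>2 / 16) ^ j))
      = (\<lambda>x. x ^ k * (1 - x\<^sup>2 / 16) ^ Suc j)"
    by (simp add: fun_eq_iff algebra_simps power2_eq_square)
  finally show ?case by simp
qed

text \<open>Uniform convergence on [-4, 4] permits integration term by term; the prefactor of the
  series shifts the exponent to j + 4. The values \<open>J\<close> are left open so that even and
  odd moments can both be inserted.\<close>

lemma USp4_trace_density_moment_sums:
  assumes "\<And>j. ((\<lambda>x. x ^ k * (1 - x\<^sup>2 / 16) ^ (j + 4)) has_integral J j) {-4..4::real}"
  shows "(\<lambda>j. gauss_term (3/2) (5/2) 5 j * J j / (4 * pi)) sums integral {-4..4} (\<lambda>x. x ^ k * USp4_trace_density x)"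
proof -
  define h where "h x = 1 / (4 * pi) * x ^ k * (1 - x\<^sup>2 / 16) ^ 4" for x :: real
  define P where "P N x = h x * (\<Sum>j<N. gauss_term (3/2) (5/2) 5 j * (1 - x\<^sup>2 / 16) ^ j)" for N and x :: real
  have cont_h: "continuous_on {-4..4} h"
    unfolding h_def by (intro continuous_intros) auto
  have "uniform_limit {-4..4} (\<lambda>N x. \<Sum>j<N. gauss_term (3/2) (5/2) 5 j * (1 - x\<^sup>2 / 16) ^ j)
      (\<lambda>x. hyp2F1 (3/2) (5/2) 5 (1 - x\<^sup>2 / 16)) sequentially"
    by (rule uniform_limit_compose'[OF uniform_limit_hyp2F1]) (use one_minus_square_bounds in auto)
  then have "uniform_limit {-4..4} P (\<lambda>x. h x * hyp2F1 (3/2) (5/2) 5 (1 - x\<^sup>2 / 16)) sequentially"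
    unfolding P_def
  proof (intro uniform_lim_mult uniform_limit_const)
    show "bounded (h ` {-4..4})"
      by (intro compact_imp_bounded compact_continuous_image cont_h) simp
    show "bounded ((\<lambda>x::real. hyp2F1 (3/2) (5/2) 5 (1 - x\<^sup>2 / 16)) ` {-4..4})"
      by (intro compact_imp_bounded compact_continuous_image continuous_on_hyp2F1_trace) simp
  qed
  also have "(\<lambda>x. h x * hyp2F1 (3/2) (5/2) 5 (1 - x\<^sup>2 / 16)) = (\<lambda>x. x ^ k * USp4_trace_density x)"
    by (simp add: h_def USp4_trace_density_def fun_eq_iff)
  finally have lim: "uniform_limit {-4..4} P (\<lambda>x. x ^ k * USp4_trace_density x) sequentially" .
  have cont_P: "continuous_on {-4..4} (P N)" for N
    unfolding P_def by (intro continuous_intros cont_h) auto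
  obtain I L where I: "\<And>N. (P N has_integral I N) {-4..4}"
    and L: "((\<lambda>x. x ^ k * USp4_trace_density x) has_integral L) {-4..4}" and IL: "I \<longlonglongrightarrow> L"
    by (rule uniform_limit_integral[OF lim cont_P]) auto
  have "I N = (\<Sum>j<N. gauss_term (3/2) (5/2) 5 j * J j / (4 * pi))" for N
  proof -
    have "((\<lambda>x. \<Sum>j<N. gauss_term (3/2) (5/2) 5 j / (4 * pi) * (x ^ k * (1 - x\<^sup>2 / 16) ^ (j + 4))) has_integral
        (\<Sum>j<N. gauss_term (3/2) (5/2) 5 j / (4 * pi) * J j)) {-4..4}"
      by (intro has_integral_sum has_integral_mult_right assms) simp
    also have "(\<lambda>x. \<Sum>j<N. gauss_term (3/2) (5/2) 5 j / (4 * pi) * (x ^ k * (1 - x\<^sup>2 / 16) ^ (j + 4))) = P N"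
      by (simp add: P_def h_def fun_eq_iff sum_distrib_left power_add mult_ac)
    finally show ?thesis
      using has_integral_unique[OF I] by simp
  qed
  then have "I = (\<lambda>N. \<Sum>j<N. gauss_term (3/2) (5/2) 5 j * J j / (4 * pi))"
    by (rule ext)
  then show ?thesis
    using IL integral_unique[OF L] by (simp add: sums_def)
qed

lemma USp4_trace_density_odd_moment:
  assumes "odd k"
  shows "integral {-4..4} (\<lambda>x. x ^ k * USp4_trace_density x) = 0"
  using USp4_trace_density_moment_sums[OF has_integral_odd_moment[OF assms]] sums_unique2[OF sums_zero]
  by simp

text \<open>Since (j + 4)! = 24 (5)_j, the parameter 5 cancels; since (r)_(j + 5) = (r)_5 (r + 5)_j,
  the parameter r + 5 takes its place. Gauss' theorem then evaluates the series at 1.\<close>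

lemma USp4_trace_density_even_moment:
  "integral {-4..4} (\<lambda>x. x ^ (2 * n) * USp4_trace_density x) =
     4 ^ (2 * n + 1) * 6 / pi * Gamma (real n + 1 / 2) * Gamma (real n + 3 / 2) / (Gamma (real n + 4) * Gamma (real n + 3))"
proof -
  define r where "r = real n + 1 / 2"
  have r: "r > 0" by (simp add: r_def)
  have "gauss_term (3/2) (5/2) 5 j * (4 ^ (2 * n + 1) * fact (j + 4) / pochhammer r (j + 4 + 1)) / (4 * pi)
    = 4 ^ (2 * n + 1) * 6 / (pi * pochhammer r 5) * gauss_term (3/2) (5/2) (r + 5) j" for j
  proof -
    have "fact (4 + j) = pochhammer 1 4 * pochhammer (1 + of_nat 4) j" for j
      unfolding pochhammer_fact by (rule pochhammer_product')
    then have f: "fact (j + 4) = 24 * pochhammer (5::real) j"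
      by (simp add: add.commute pochhammer_fact[symmetric] fact_numeral)
    have g: "pochhammer r (j + 4 + 1) = pochhammer r 5 * pochhammer (r + 5) j"
      using pochhammer_product'[of r 5 j] by (simp add: add.commute)
    have "pochhammer (5::real) j \<noteq> 0"
      using pochhammer_pos[of "5::real" j] by simp
    then show ?thesis
      unfolding f g gauss_term_def by (simp add: mult_ac)
  qed
  then have "(\<lambda>j. 4 ^ (2 * n + 1) * 6 / (pi * pochhammer r 5) * gauss_term (3/2) (5/2) (r + 5) j)
      sums integral {-4..4} (\<lambda>x. x ^ (2 * n) * USp4_trace_density x)"
    using USp4_trace_density_moment_sums[OF has_integral_even_moment[of n "_ + 4"]] unfolding r_def[symmetric] by simp
  moreover have "(\<lambda>j. 4 ^ (2 * n + 1) * 6 / (pi * pochhammer r 5) * gauss_term (3/2) (5/2) (r + 5) j) sums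
     (4 ^ (2 * n + 1) * 6 / (pi * pochhammer r 5) * (Gamma (r + 5) * Gamma (r + 5 - 3/2 - 5/2) / (Gamma (r + 5 - 3/2) * Gamma (r + 5 - 5/2))))"
    using r by (intro sums_mult gauss_summation) auto
  ultimately have "integral {-4..4} (\<lambda>x. x ^ (2 * n) * USp4_trace_density x) =
     4 ^ (2 * n + 1) * 6 / (pi * pochhammer r 5) * (Gamma (r + 5) * Gamma (r + 5 - 3/2 - 5/2) / (Gamma (r + 5 - 3/2) * Gamma (r + 5 - 5/2)))"
    by (rule sums_unique2)
  also have "pochhammer r 5 = Gamma (r + 5) / Gamma r"
    using pochhammer_Gamma[of r 5] r by (auto simp: nonpos_Ints_def)
  also have "4 ^ (2 * n + 1) * 6 / (pi * (Gamma (r + 5) / Gamma r)) * (Gamma (r + 5) * Gamma (r + 5 - 3/2 - 5/2) / (Gamma (r + 5 - 3/2) * Gamma (r + 5 - 5/2)))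
    = 4 ^ (2 * n + 1) * 6 / pi * Gamma r * Gamma (r + 5 - 3/2 - 5/2) / (Gamma (r + 5 - 3/2) * Gamma (r + 5 - 5/2))"
    using less_imp_neq[OF Gamma_real_pos, of "r + 5"] r by simp
  finally show ?thesis
    by (simp add: r_def algebra_simps)
qed

text \<open>Odd moments vanish on both sides. For k = 2 n each of the four Gamma factors moves by
  one, and doubling their arguments yields k + 1, k + 3, k + 8 and k + 6.\<close>

lemma USp4_trace_density_moment_recurrence:
  defines "\<nu> \<equiv> \<lambda>k. integral {-4..4} (\<lambda>x. x ^ k * USp4_trace_density x)"
  shows "real ((k + 6) * (k + 8)) * \<nu> (k + 2) = real (16 * (k + 1) * (k + 3)) * \<nu> k"
    and "\<nu> 1 = 0" and "\<nu> 0 = 1"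
proof -
  have G: "Gamma (z + 1) = z * Gamma z" if "z > 0" for z :: real
    using that by (intro Gamma_plus1) (auto simp: nonpos_Ints_def)
  show "real ((k + 6) * (k + 8)) * \<nu> (k + 2) = real (16 * (k + 1) * (k + 3)) * \<nu> k"
  proof (cases "even k")
    case False
    then show ?thesis
      unfolding \<nu>_def by (simp add: USp4_trace_density_odd_moment del: power_Suc add_2_eq_Suc add_2_eq_Suc')
  next
    case True
    then obtain n where k: "k = 2 * n" by (elim evenE)
    define x y u v where "x = real n + 1 / 2" and "y = real n + 3 / 2" and "u = real n + 4" and "v = real n + 3"
    have pos: "x > 0" "y > 0" "u > 0" "v > 0"
      by (simp_all add: x_def y_def u_def v_def)
    have "\<nu> (k + 2) = 4 ^ (2 * (n + 1) + 1) * 6 / pi * Gamma (x + 1) * Gamma (y + 1) / (Gamma (u + 1) * Gamma (v + 1))"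
      using USp4_trace_density_even_moment[of "n + 1"]
      unfolding \<nu>_def k x_def y_def u_def v_def by (simp add: add_ac)
    then have "\<nu> (k + 2) * (u * v) = 16 * (x * y) * (4 ^ (2 * n + 1) * 6 / pi * Gamma x * Gamma y / (Gamma u * Gamma v))"
      using pos by (simp add: G power_add)
    also have "4 ^ (2 * n + 1) * 6 / pi * Gamma x * Gamma y / (Gamma u * Gamma v) = \<nu> k"
      unfolding \<nu>_def k x_def y_def u_def v_def by (rule USp4_trace_density_even_moment[symmetric])
    finally have eq: "\<nu> (k + 2) * (u * v) = 16 * (x * y) * \<nu> k" .
    have "real ((k + 6) * (k + 8)) = 4 * (u * v)" "real (16 * (k + 1) * (k + 3)) = 64 * (x * y)"
      by (simp_all add: k x_def y_def u_def v_def algebra_simps)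
    moreover have "4 * (u * v) * \<nu> (k + 2) = 64 * (x * y) * \<nu> k"
      using eq by (simp del: add_2_eq_Suc add_2_eq_Suc' add: mult_ac)
    ultimately show ?thesis
      by (simp only:)
  qed
  show "\<nu> 1 = 0"
    unfolding \<nu>_def by (rule USp4_trace_density_odd_moment) simp
  have "Gamma (3 / 2 :: real) = 1 / 2 * sqrt pi"
    using G[of "1 / 2"] by (simp add: Gamma_one_half_real)
  then have "2 * (sqrt pi * Gamma (3 / 2)) = pi"
    by (simp only:) simp
  moreover have "Gamma (4 :: real) = 6" "Gamma (3 :: real) = 2"
    using Gamma_fact[of 3, where 'a = real] Gamma_fact[of 2, where 'a = real] by (simp_all add: fact_numeral)
  ultimately show "\<nu> 0 = 1"
    using USp4_trace_density_even_moment[of 0] unfolding \<nu>_def by (simp add: Gamma_one_half_real)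
qed

section \<open>Determination of a continuous function by its moments\<close>

text \<open>The function \<open>d\<close> is orthogonal to all polynomials. For a polynomial
  \<open>g\<close> uniformly close to \<open>d\<close>, the integral of d^2 equals that of (d - g)
  d, which is arbitrarily small.\<close>

lemma continuous_zero_if_moments_zero:
  fixes d :: "real \<Rightarrow> real"
  assumes d: "continuous_on {a..b} d" and ab: "a < b"
    and moments: "\<And>k. integral {a..b} (\<lambda>x. x ^ k * d x) = 0"
    and x: "x \<in> {a..b}"
  shows "d x = 0"
proof -
  have int: "h integrable_on {a..b}" if "continuous_on {a..b} h" for h :: "real \<Rightarrow> real"
    using that by (rule integrable_continuous_interval)
  have "bounded (d ` {a..b})"
    by (intro compact_imp_bounded compact_continuous_image d) simp
  then obtain B where "B > 0" and "\<forall>y\<in>d ` {a..b}. norm y \<le> B"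
    unfolding bounded_pos by blast
  then have B: "\<bar>d x\<bar> \<le> B" if "x \<in> {a..b}" for x
    using that by simp
  have "integral {a..b} (\<lambda>x. d x * d x) \<le> 0 + e" if "e > 0" for e
  proof -
    \<comment> \<open>Chosen so that the final bound \<epsilon> B (b - a) is exactly e.\<close>
    define \<epsilon> where "\<epsilon> = e / (B * (b - a))"
    have "\<epsilon> > 0" using that ab \<open>B > 0\<close> by (simp add: \<epsilon>_def)
    obtain g where "real_polynomial_function g" and g: "\<And>x. x \<in> {a..b} \<Longrightarrow> \<bar>d x - g x\<bar> < \<epsilon>"
      using Stone_Weierstrass_real_polynomial_function[OF compact_Icc d \<open>\<epsilon> > 0\<close>] by blast
    then obtain c n where c: "g = (\<lambda>x. \<Sum>i\<le>n. c i * x ^ i)"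
      using real_polynomial_function_imp_sum by blast
    have cont_g: "continuous_on {a..b} g"
      unfolding c by (intro continuous_intros)
    have "integral {a..b} (\<lambda>x. g x * d x) = integral {a..b} (\<lambda>x. \<Sum>i\<le>n. c i * (x ^ i * d x))"
      by (simp add: c sum_distrib_right mult.assoc)
    also have "\<dots> = (\<Sum>i\<le>n. integral {a..b} (\<lambda>x. c i * (x ^ i * d x)))"
      by (intro integral_sum int continuous_intros d) simp
    also have "\<dots> = 0"
      by (simp add: moments)
    finally have g0: "integral {a..b} (\<lambda>x. g x * d x) = 0" .
    have "integral {a..b} (\<lambda>x. d x * d x) = integral {a..b} (\<lambda>x. (d x - g x) * d x) + integral {a..b} (\<lambda>x. g x * d x)"
      by (subst integral_add[symmetric]) (auto intro!: int continuous_intros d cont_g simp: algebra_simps)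
    also have "\<dots> \<le> integral {a..b} (\<lambda>x. \<epsilon> * B)"
      unfolding g0 add_0_right
    proof (intro integral_le int continuous_intros d cont_g)
      fix x assume x: "x \<in> {a..b}"
      have "(d x - g x) * d x \<le> \<bar>d x - g x\<bar> * \<bar>d x\<bar>"
        by (metis abs_ge_self abs_mult)
      also have "\<dots> \<le> \<epsilon> * B"
        using g[OF x] B[OF x] \<open>\<epsilon> > 0\<close> by (intro mult_mono) auto
      finally show "(d x - g x) * d x \<le> \<epsilon> * B" .
    qed
    also have "\<dots> = 0 + e"
      using ab \<open>B > 0\<close> by (simp add: \<epsilon>_def)
    finally show ?thesis .
  qed
  then have "integral {a..b} (\<lambda>x. d x * d x) \<le> 0"
    by (rule field_le_epsilon)
  moreover have "integral {a..b} (\<lambda>x. d x * d x) \<ge> 0"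
    by (intro integral_nonneg int continuous_intros d) simp
  ultimately have "integral {a..b} (\<lambda>x. d x * d x) = 0"
    by simp
  moreover have "continuous_on {a..b} (\<lambda>x. d x * d x)"
    by (intro continuous_intros d)
  ultimately have "d x * d x = 0"
    using integral_eq_0_iff[of a b "\<lambda>x. d x * d x"] ab x by simp
  then show ?thesis by simp
qed

subsection \<open>Comparison of the moments\<close>

text \<open>The leading coefficient (k + 6) (k + 8) is never 0, so the recurrence of step two
  determines a sequence from its first two values.\<close>

lemma moment_eqI:
  fixes \<mu> \<nu> :: "nat \<Rightarrow> real"
  assumes "\<And>k. real ((k + 6) * (k + 8)) * \<mu> (k + 2) = real (16 * (k + 1) * (k + 3)) * \<mu> k"
    and "\<And>k. real ((k + 6) * (k + 8)) * \<nu> (k + 2) = real (16 * (k + 1) * (k + 3)) * \<nu> k"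
    and "\<mu> 0 = \<nu> 0" "\<mu> 1 = \<nu> 1"
  shows "\<mu> k = \<nu> k"
proof (induction k rule: induct_nat_012)
  case (ge2 k)
  have "real ((k + 6) * (k + 8)) * \<mu> (k + 2) = real ((k + 6) * (k + 8)) * \<nu> (k + 2)"
    unfolding assms(1,2) ge2.IH(1) ..
  moreover have "real ((k + 6) * (k + 8)) \<noteq> 0"
    by simp
  ultimately have "\<mu> (k + 2) = \<nu> (k + 2)"
    by (simp only: mult_cancel_left) simp
  then show ?case
    by simp
qed (use assms(3,4) in simp_all)

theorem theorem5p2:
  fixes M :: "(complex^4^4) measure" and f\<^sub>\<tau> :: "real \<Rightarrow> real" and x :: real
  assumes "normalized_haar_measure USp4 M"
    and "continuous_trace_density M f\<^sub>\<tau>"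
    and "\<bar>x\<bar> < 4"
  shows "f\<^sub>\<tau> x = 1 / (4 * pi) * (1 - x\<^sup>2 / 16) ^ 4 * hyp2F1 (3/2) (5/2) 5 (1 - x\<^sup>2 / 16)"
proof -
  interpret USp4_haar M
    using assms(1) by unfold_locales
  have cont: "continuous_on {-4..4} f\<^sub>\<tau>"
    using assms(2) by (simp add: continuous_trace_density_def)
  \<comment> \<open>The defining property of the density for the test function x^k. Continuity of
    the integrand lets the Lebesgue integral be read as a gauge integral.\<close>
  have density: "(\<integral>m. Re (trace m) ^ k \<partial>M) = integral {-4..4} (\<lambda>x. x ^ k * f\<^sub>\<tau> x)" for k
  proof -
    have "continuous_on {-4..4} (\<lambda>x. x ^ k * f\<^sub>\<tau> x)"
      by (intro continuous_intros cont)
    then have "(LBINT x:{-4..4}. x ^ k * f\<^sub>\<tau> x) = integral {-4..4} (\<lambda>x. x ^ k * f\<^sub>\<tau> x)"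
      by (intro set_borel_integral_eq_integral borel_integrable_atLeastAtMost')
    moreover have "(\<integral>m. Re (trace m) ^ k \<partial>M) = (LBINT x:{-4..4}. x ^ k * f\<^sub>\<tau> x)"
      using assms(2) unfolding continuous_trace_density_def
      by (elim conjE allE[of _ "\<lambda>x. x ^ k"] mp) (intro continuous_intros)
    ultimately show ?thesis
      by (rule trans[rotated])
  qed
  have moments: "(\<integral>m. Re (trace m) ^ k \<partial>M) = integral {-4..4} (\<lambda>x. x ^ k * USp4_trace_density x)" for k
    by (rule moment_eqI)
      (simp_all only: trace_moment_recurrence USp4_trace_density_moment_recurrence)
  have "f\<^sub>\<tau> x - USp4_trace_density x = 0"
  proof (rule continuous_zero_if_moments_zero[of "-4" 4 "\<lambda>x. f\<^sub>\<tau> x - USp4_trace_density x"])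
    show "continuous_on {-4..4} (\<lambda>x. f\<^sub>\<tau> x - USp4_trace_density x)"
      by (intro continuous_intros cont continuous_on_USp4_trace_density)
    show "integral {-4..4} (\<lambda>x. x ^ k * (f\<^sub>\<tau> x - USp4_trace_density x)) = 0" for k
    proof -
      have "integral {-4..4} (\<lambda>x. x ^ k * (f\<^sub>\<tau> x - USp4_trace_density x))
        = integral {-4..4} (\<lambda>x. x ^ k * f\<^sub>\<tau> x) - integral {-4..4} (\<lambda>x. x ^ k * USp4_trace_density x)"
        unfolding right_diff_distrib
        by (intro integral_diff integrable_continuous_interval continuous_intros cont continuous_on_USp4_trace_density)
      then show ?thesis
        using density[of k] moments[of k] by simp
    qed
  qed (use assms(3) in auto)
  then show ?thesis
    by (simp add: USp4_trace_density_def)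
qed

end
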